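(* Let $u$ be any minimizer of $TV$ in $BV_{\diamond,1}$, let $\Theta_+:=\{u>0\}$, and let $\Omega_-$ be a Cheeger set of $\Omega\setminus\Theta_+$. Then there exists a minimizer of $TV$ in $BV_{\diamond,1}$ of the form $$u_c := 1_{\Omega_1} - \frac{|\Omega_1|}{|\Omega_-|}1_{\Omega_-},$$ where $\Omega_1$ is a minimizer of the functional $$\mathcal T(E) := \operatorname{Per}(E) + \frac{\operatorname{Per}(\Omega_-)}{|\Omega_-|}|E|$$ over Borel sets $E$ with $\Omega_s\subset E\subset\Omega\setminus\Omega_-$. In fact, for every $0\le t<1$, the level set $E_t:=\{u>t\}$ minimizes $\mathcal T$ over Borel sets $E$ with $\Omega_s\subset E\subset\Omega\setminus\Omega_-$.
   Context: $\Omega\subset\mathbb{R}^2$ is a bounded domain (of finite perimeter) and $\Omega_s\subset\Omega$ is a measurable set of finite perimeter with $|\Omega_s|>0$ and $|\Omega\setminus\Omega_s|>0$. $|E|$ is Lebesgue measure; $TV(v)=|Dv|(\mathbb{R}^2)$ is the total variation in all of $\mathbb{R}^2$ (so jumps across $\partial\Omega$ are counted); $\operatorname{Per}(E)=TV(1_E)$. Sets are identified when they differ by a Lebesgue-null set; inclusions are understood up to null sets. $$BV_{\diamond,1}:=\Big\{v\in BV(\mathbb{R}^2):\ \int_\Omega v=0,\ v= 1\text{ a.e. in }\Omega_s,\ v= 0\text{ a.e. in }\mathbb{R}^2\setminus\Omega\Big\}.$$ A Cheeger set of a set $\Omega_0$ of finite perimeter is a set $E_0\subset\Omega_0$ minimizing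 $\operatorname{Per}(E)/|E|$ among subsets $E$ of $\Omega_0$ with $|E|>0$. *)

theory Defs
  imports "HOL-Analysis.Analysis"
begin

text \<open>
  Functions and sets are concrete representatives of their almost-everywhere classes: functions on
  the plane are Lebesgue measurable, sets are Lebesgue measurable, and inclusions hold up to
  null sets.
\<close>

definition ae_subset :: "(real^2) set \<Rightarrow> (real^2) set \<Rightarrow> bool" where
  "ae_subset A B \<longleftrightarrow> (AE x in lebesgue. x \<in> A \<longrightarrow> x \<in> B)"

definition divergence :: "(real^2 \<Rightarrow> real^2) \<Rightarrow> real^2 \<Rightarrow> real" where
  "divergence \<phi> x = (\<Sum>i\<in>UNIV. frechet_derivative \<phi> (at x) (axis i 1) $ i)"

text \<open>
  The continuously differentiable, compactly supported vector fields on the plane with Euclidean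
  norm at most 1 everywhere. In finite dimension, continuity of the derivative in operator norm is
  the same as continuity of every directional derivative.
\<close>

definition test_fields :: "(real^2 \<Rightarrow> real^2) set" where
  "test_fields = {\<phi>. (\<forall>x. \<phi> differentiable (at x)) \<and>
     (\<forall>h. continuous_on UNIV (\<lambda>x. frechet_derivative \<phi> (at x) h)) \<and>
     compact (closure {x. \<phi> x \<noteq> 0}) \<and> (\<forall>x. norm (\<phi> x) \<le> 1)}"

text \<open>
  The total variation over the whole plane of a locally integrable function. The function
  \<^const>\<open>ennreal\<close> sends negative reals to 0; this does not change the supremum, because the zero
  field is a test field.
\<close>

definition TV :: "(real^2 \<Rightarrow> real) \<Rightarrow> ennreal" where
  "TV v = (SUP \<phi>\<in>test_fields. ennreal (\<integral>x. v x * divergence \<phi> x \<partial>lebesgue))"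

definition Per :: "(real^2) set \<Rightarrow> ennreal" where
  "Per E = TV (indicat_real E)"

definition BV :: "(real^2 \<Rightarrow> real) set" where
  "BV = {v. integrable lebesgue v \<and> TV v < \<infinity>}"

definition BV_diamond_1 :: "(real^2) set \<Rightarrow> (real^2) set \<Rightarrow> (real^2 \<Rightarrow> real) set" where
  "BV_diamond_1 \<Omega> \<Omega>s = {v \<in> BV. (LINT x:\<Omega>|lebesgue. v x) = 0 \<and>
     (AE x in lebesgue. x \<in> \<Omega>s \<longrightarrow> v x = 1) \<and>
     (AE x in lebesgue. x \<notin> \<Omega> \<longrightarrow> v x = 0)}"

definition cheeger_set :: "(real^2) set \<Rightarrow> (real^2) set \<Rightarrow> bool" where
  "cheeger_set \<Omega>0 E0 \<longleftrightarrow>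
     is_arg_min (\<lambda>E. Per E / emeasure lebesgue E)
       (\<lambda>E. E \<in> sets lebesgue \<and> ae_subset E \<Omega>0 \<and> emeasure lebesgue E > 0) E0"

definition T_functional :: "(real^2) set \<Rightarrow> (real^2) set \<Rightarrow> ennreal" where
  "T_functional \<Omega>m E = Per E + Per \<Omega>m / emeasure lebesgue \<Omega>m * emeasure lebesgue E"

text \<open>
  The competitors are the Borel sets between \<open>\<Omega>s\<close> and \<open>\<Omega> - \<Omega>m\<close>. A set agrees with a Borel set up to a
  null set iff it is Lebesgue measurable, so with sets identified modulo null sets the
  competitors are the Lebesgue measurable sets.
\<close>

definition T_competitor :: "(real^2) set \<Rightarrow> (real^2) set \<Rightarrow> (real^2) set \<Rightarrow> (real^2) set \<Rightarrow> bool" where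
  "T_competitor \<Omega> \<Omega>s \<Omega>m E \<longleftrightarrow>
     E \<in> sets lebesgue \<and> ae_subset \<Omega>s E \<and> ae_subset E (\<Omega> - \<Omega>m)"

end

theory Submission
  imports Defs
begin

text \<open>
  Write \<open>\<lambda> = Per \<Omega>m / |\<Omega>m|\<close>. Since \<open>u\<close> has integral \<open>0\<close>, the integrals of \<open>u\<^sup>+\<close> and \<open>u\<^sup>-\<close> agree. The
  sets \<open>{u\<^sup>- > t}\<close> are competitors in the Cheeger problem, so the coarea inequality gives
  \<open>TV u \<ge> TV u\<^sup>+ + TV u\<^sup>- \<ge> \<integral>\<^sub>0\<^sup>\<infinity> Per {u > t} dt + \<lambda> \<integral> u\<^sup>-\<close>, and \<open>\<integral> u\<^sup>- = \<integral> u\<^sup>+\<close> is at least the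
  integral of \<open>|{u > t}|\<close> over \<open>0 \<le> t < 1\<close>. Hence \<open>TV u\<close> is at least the integral of
  \<open>T_functional \<Omega>m {u > t}\<close> over \<open>0 \<le> t < 1\<close>. On the other hand every competitor \<open>E\<close> yields the
  admissible function \<open>1\<^sub>E - |E|/|\<Omega>m| 1\<^bsub>\<Omega>m\<^esub>\<close>, whose total variation is at most \<open>T_functional \<Omega>m E\<close>, so
  \<open>TV u \<le> T_functional \<Omega>m E\<close>. Therefore almost every level set is optimal, and lower semicontinuity
  from the right extends this to every \<open>t\<close> in \<open>[0, 1)\<close>.

  The coarea inequality needs no differentiation of monotone functions: with \<open>m(t) = TV (min w t)\<close>,
  additivity of \<open>TV\<close> under truncation and lower semicontinuity give
  \<open>Per {w > t} \<le> liminf (m(t+h) - m(t))/h\<close>, and Fatou's lemma integrates this. Additivity under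
  truncation is proved for smooth functions first and then by mollification.
\<close>

section \<open>Integration and test fields\<close>

lemma lborel_distr_translate: "distr lborel borel (\<lambda>y. a + y) = (lborel :: 'a::euclidean_space measure)"
  using lborel_affine[of 1 a] by (simp add: density_1)

lemma lborel_distr_reflect: "distr lborel borel (\<lambda>y. a - y) = (lborel :: 'a::euclidean_space measure)"
  using lborel_affine[of "-1" a] by (simp add: density_1)

lemma
  fixes f :: "'a::euclidean_space \<Rightarrow> 'b::{banach, second_countable_topology}"
  assumes [measurable]: "f \<in> borel_measurable borel"
  shows integral_lborel_reflect: "(\<integral>y. f (a - y) \<partial>lborel) = (\<integral>y. f y \<partial>lborel)"
    and integrable_lborel_reflect: "integrable lborel (\<lambda>y. f (a - y)) = integrable lborel f"
    and integral_lborel_translate: "(\<integral>y. f (a + y) \<partial>lborel) = (\<integral>y. f y \<partial>lborel)"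
    and integrable_lborel_translate: "integrable lborel (\<lambda>y. f (a + y)) = integrable lborel f"
proof -
  have [measurable]: "(\<lambda>y::'a. a - y) \<in> measurable lborel borel" "(\<lambda>y::'a. a + y) \<in> measurable lborel borel"
    by simp_all
  show "(\<integral>y. f (a - y) \<partial>lborel) = (\<integral>y. f y \<partial>lborel)"
    using integral_distr[of "\<lambda>y. a - y" lborel borel f] by (simp add: lborel_distr_reflect)
  show "integrable lborel (\<lambda>y. f (a - y)) = integrable lborel f"
    using integrable_distr_eq[of "\<lambda>y. a - y" lborel borel f] by (simp add: lborel_distr_reflect)
  show "(\<integral>y. f (a + y) \<partial>lborel) = (\<integral>y. f y \<partial>lborel)"
    using integral_distr[of "\<lambda>y. a + y" lborel borel f] by (simp add: lborel_distr_translate)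
  show "integrable lborel (\<lambda>y. f (a + y)) = integrable lborel f"
    using integrable_distr_eq[of "\<lambda>y. a + y" lborel borel f] by (simp add: lborel_distr_translate)
qed

lemma nn_integral_lborel_translate:
  fixes f :: "'a::euclidean_space \<Rightarrow> ennreal"
  assumes [measurable]: "f \<in> borel_measurable borel"
  shows "(\<integral>\<^sup>+y. f (a + y) \<partial>lborel) = (\<integral>\<^sup>+y. f y \<partial>lborel)"
  using nn_integral_distr[of "\<lambda>y. a + y" lborel borel f] by (simp add: lborel_distr_translate)

section \<open>Continuous functions that vanish outside a ball\<close>

lemma cts_vanishing_bounded:
  fixes f :: "'a::euclidean_space \<Rightarrow> 'b::real_normed_vector"
  assumes "continuous_on UNIV f" and "\<And>x. norm x > R \<Longrightarrow> f x = 0"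
  obtains B where "B > 0" "\<And>x. norm (f x) \<le> B"
proof -
  have "bounded (f ` cball 0 R)"
    using assms(1) by (intro compact_imp_bounded compact_continuous_image) (auto intro: continuous_on_subset)
  then obtain B where B: "B > 0" "\<And>x. x \<in> cball 0 R \<Longrightarrow> norm (f x) \<le> B"
    unfolding bounded_pos by auto
  have "norm (f x) \<le> B" for x
    using B assms(2)[of x] by (cases "norm x > R") auto
  with B(1) that show ?thesis by blast
qed

lemma cts_vanishing_integrable:
  fixes f :: "'a::euclidean_space \<Rightarrow> 'b::{banach, second_countable_topology}"
  assumes "continuous_on UNIV f" and "\<And>x. norm x > R \<Longrightarrow> f x = 0"
  shows "integrable lborel f"
proof -
  have "integrable lborel (\<lambda>x. indicator (cball 0 R) x *\<^sub>R f x)"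
    using assms(1) by (intro borel_integrable_compact) (auto intro: continuous_on_subset)
  also have "(\<lambda>x. indicator (cball 0 R) x *\<^sub>R f x) = f"
    using assms(2) by (auto simp: fun_eq_iff indicator_def)
  finally show ?thesis .
qed

text \<open>Compactness gives uniform continuity on the ball of radius R + 1. If the distance is
  also kept below 1, two points either both lie in that ball or both lie outside the ball of radius
  R, where \<open>f\<close> is 0.\<close>

lemma cts_vanishing_uniform:
  fixes f :: "'a::euclidean_space \<Rightarrow> 'b::real_normed_vector"
  assumes c: "continuous_on UNIV f" and z: "\<And>x. norm x > R \<Longrightarrow> f x = 0" and "e > 0"
  obtains d where "d > 0" "\<And>x y. norm (x - y) < d \<Longrightarrow> norm (f x - f y) < e"
proof -
  have "uniformly_continuous_on (cball 0 (R+1)) f"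
    using c by (intro compact_uniformly_continuous) (auto intro: continuous_on_subset)
  then obtain d where d: "d > 0"
    "\<And>x y. x \<in> cball 0 (R+1) \<Longrightarrow> y \<in> cball 0 (R+1) \<Longrightarrow> dist x y < d \<Longrightarrow> dist (f x) (f y) < e"
    using \<open>e > 0\<close> unfolding uniformly_continuous_on_def by (metis dist_commute)
  have "norm (f x - f y) < e" if xy: "norm (x - y) < min d 1" for x y
  proof (cases "x \<in> cball 0 (R+1) \<and> y \<in> cball 0 (R+1)")
    case True
    then show ?thesis using d(2)[of x y] xy by (auto simp: dist_norm)
  next
    case False
    have "norm x \<le> norm y + norm (x - y)" "norm y \<le> norm x + norm (x - y)"
      using norm_triangle_sub[of x y] norm_triangle_sub[of y x] by (auto simp: norm_minus_commute)
    then have "norm x > R" "norm y > R" using False xy by auto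
    then show ?thesis using z \<open>e > 0\<close> by simp
  qed
  with d(1) that[of "min d 1"] show ?thesis by auto
qed

section \<open>Difference quotients and integrals of derivatives\<close>

lemma has_derivative_vanishing:
  fixes f :: "'a::real_normed_vector \<Rightarrow> 'b::real_normed_vector"
  assumes d: "(f has_derivative D) (at x)" and z: "\<And>x. norm x > R \<Longrightarrow> f x = 0" and x: "norm x > R"
  shows "D = (\<lambda>h. 0)"
proof -
  have "open {x::'a. norm x > R}" by (intro open_Collect_less continuous_intros)
  then have "((\<lambda>x. 0) has_derivative D) (at x)"
    using d x z by (intro has_derivative_transform_within_open[OF d, of "{x. norm x > R}"]) auto
  then show ?thesis using has_derivative_unique has_derivative_const by blast
qed

lemma has_derivative_quotient_lim:
  fixes f :: "'a::real_normed_vector \<Rightarrow> real"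
  assumes d: "(f has_derivative D) (at x)"
  shows "(\<lambda>n. real (Suc n) * (f (x + (1 / real (Suc n)) *\<^sub>R e) - f x)) \<longlonglongrightarrow> D e"
proof -
  have "((\<lambda>t. x + t *\<^sub>R e) has_derivative (\<lambda>t. t *\<^sub>R e)) (at (0::real))"
    by (auto intro!: derivative_eq_intros)
  then have "((\<lambda>t. f (x + t *\<^sub>R e)) has_derivative (\<lambda>t. D (t *\<^sub>R e))) (at (0::real))"
    using has_derivative_compose[of "\<lambda>t. x + t *\<^sub>R e" "\<lambda>t. t *\<^sub>R e" "0::real" UNIV f D] d by simp
  then have "DERIV (\<lambda>t. f (x + t *\<^sub>R e)) 0 :> D e"
    using linear_scale[OF has_derivative_linear[OF d]]
    by (simp add: has_field_derivative_def mult_commute_abs)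
  then have lim: "((\<lambda>t. (f (x + t *\<^sub>R e) - f x) / t) \<longlongrightarrow> D e) (at 0)"
    by (simp add: DERIV_def)
  have "filterlim (\<lambda>n. 1 / real (Suc n)) (at 0) sequentially"
    using LIMSEQ_Suc[OF lim_1_over_n[where 'a=real]] by (auto simp: filterlim_at)
  from filterlim_compose[OF lim this] show ?thesis by (simp add: mult.commute)
qed

text \<open>By translation invariance the difference quotients of \<open>f\<close> along
  \<open>e\<close> have integral 0. The mean value theorem bounds them by a bound for the
  directional derivative, so dominated convergence carries the value 0 over to the
  derivative.\<close>

lemma integral_derivative_zero:
  fixes f :: "'a::euclidean_space \<Rightarrow> real"
  assumes d: "\<And>x. (f has_derivative D x) (at x)" and c: "continuous_on UNIV (\<lambda>x. D x e)"
    and z: "\<And>x. norm x > R \<Longrightarrow> f x = 0"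
  shows "(\<integral>x. D x e \<partial>lborel) = 0"
proof -
  have cf: "continuous_on UNIV f"
    using d by (rule has_derivative_continuous_on)
  note [measurable] = borel_measurable_continuous_onI[OF cf] borel_measurable_continuous_onI[OF c]
  have z': "D x e = 0" if "norm x > R" for x
    using has_derivative_vanishing[OF d z that] by simp
  obtain B where B: "B > 0" "\<And>x. norm (D x e) \<le> B"
    using cts_vanishing_bounded[OF c z'] by blast
  define q where "q n x = real (Suc n) * (f (x + (1 / real (Suc n)) *\<^sub>R e) - f x)" for n x
  have lip: "\<bar>f (x + t *\<^sub>R e) - f x\<bar> \<le> B * t" if "t > 0" for x t
  proof -
    have "((\<lambda>t. f (x + t *\<^sub>R e)) has_derivative (\<lambda>h. D (x + s *\<^sub>R e) (h *\<^sub>R e))) (at s within {0..t})" for s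
    proof -
      have "((\<lambda>t. x + t *\<^sub>R e) has_derivative (\<lambda>t. t *\<^sub>R e)) (at s within {0..t})"
        by (auto intro!: derivative_eq_intros)
      from has_derivative_compose[OF this d] show ?thesis .
    qed
    from mvt_simple[OF that this]
    obtain s where "f (x + t *\<^sub>R e) - f (x + 0 *\<^sub>R e) = D (x + s *\<^sub>R e) ((t - 0) *\<^sub>R e)" by blast
    also have "\<dots> = t * D (x + s *\<^sub>R e) e"
      using linear_scale[OF has_derivative_linear[OF d]] by simp
    finally show ?thesis using B(2)[of "x + s *\<^sub>R e"] that by (simp add: abs_mult mult.commute)
  qed
  have "(\<lambda>n. \<integral>x. q n x \<partial>lborel) \<longlonglongrightarrow> (\<integral>x. D x e \<partial>lborel)"
  proof (rule integral_dominated_convergence)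
    \<comment> \<open>The step lengths \<open>1 / real (Suc n)\<close> are at most 1, so all
      quotients vanish outside one ball of radius \<open>R + norm e\<close>, which yields a common
      majorant.\<close>
    show "integrable lborel (\<lambda>x::'a. B * indicator (cball 0 (R + norm e)) x :: real)"
      using emeasure_bounded_finite[OF bounded_cball, of "0::'a" "R + norm e"]
      by (intro integrable_mult_right integrable_real_indicator) auto
    show "AE x in lborel. (\<lambda>n. q n x) \<longlonglongrightarrow> D x e"
      unfolding q_def by (intro AE_I2 has_derivative_quotient_lim[OF d])
    show "AE x in lborel. norm (q n x) \<le> B * indicator (cball 0 (R + norm e)) x" for n
    proof (rule AE_I2)
      fix x :: 'a
      show "norm (q n x) \<le> B * indicator (cball 0 (R + norm e)) x"
      proof (cases "x \<in> cball 0 (R + norm e)")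
        case True
        have "\<bar>f (x + (1 / real (Suc n)) *\<^sub>R e) - f x\<bar> \<le> B * (1 / real (Suc n))"
          by (rule lip) simp
        then have "real (Suc n) * \<bar>f (x + (1 / real (Suc n)) *\<^sub>R e) - f x\<bar>
            \<le> real (Suc n) * (B * (1 / real (Suc n)))"
          by (intro mult_left_mono) auto
        then show ?thesis using True by (simp only: q_def abs_mult real_norm_def) simp
      next
        case False
        have "norm ((1 / real (Suc n)) *\<^sub>R e) \<le> norm e"
          by (simp add: divide_le_eq distrib_left)
        moreover have "norm x \<le> norm (x + (1 / real (Suc n)) *\<^sub>R e) + norm ((1 / real (Suc n)) *\<^sub>R e)"
          using norm_triangle_ineq4[of "x + (1 / real (Suc n)) *\<^sub>R e" "(1 / real (Suc n)) *\<^sub>R e"] by simp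
        ultimately have "norm (x + (1 / real (Suc n)) *\<^sub>R e) > R" "norm x > R"
          using False norm_ge_zero[of e] unfolding mem_cball dist_0_norm by linarith+
        then show ?thesis using False z by (simp add: q_def)
      qed
    qed
  qed (auto simp: q_def)
  moreover have "(\<integral>x. q n x \<partial>lborel) = 0" for n
  proof -
    have i: "integrable lborel f" using cts_vanishing_integrable[OF cf z] by blast
    then have "integrable lborel (\<lambda>x. f (x + (1 / real (Suc n)) *\<^sub>R e))"
      "(\<integral>x. f (x + (1 / real (Suc n)) *\<^sub>R e) \<partial>lborel) = (\<integral>x. f x \<partial>lborel)"
      using integrable_lborel_translate[of f "(1 / real (Suc n)) *\<^sub>R e"]
        integral_lborel_translate[of f "(1 / real (Suc n)) *\<^sub>R e"] by (simp_all add: add.commute)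
    with i show ?thesis unfolding q_def by simp
  qed
  ultimately show ?thesis by (simp add: LIMSEQ_const_iff)
qed

section \<open>Test fields, their divergence and integration by parts\<close>

lemma test_fieldsI:
  assumes d: "\<And>x. (\<phi> has_derivative D x) (at x)" and c: "\<And>h. continuous_on UNIV (\<lambda>x. D x h)"
    and z: "\<And>x. norm x > R \<Longrightarrow> \<phi> x = 0" and n: "\<And>x. norm (\<phi> x) \<le> 1"
  shows "\<phi> \<in> test_fields" and "divergence \<phi> x = (\<Sum>i\<in>UNIV. D x (axis i 1) $ i)"
proof -
  have D: "frechet_derivative \<phi> (at x) = D x" for x
    using frechet_derivative_at[OF d] by simp
  have "{x. \<phi> x \<noteq> 0} \<subseteq> cball 0 R" using z by (auto simp: not_less[symmetric])
  then have "bounded {x. \<phi> x \<noteq> 0}" using bounded_subset bounded_cball by blast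
  then show "\<phi> \<in> test_fields"
    unfolding test_fields_def using d c n D by (auto simp: differentiable_def compact_closure)
  show "divergence \<phi> x = (\<Sum>i\<in>UNIV. D x (axis i 1) $ i)"
    by (simp add: divergence_def D)
qed

lemma test_fieldsE:
  assumes "\<phi> \<in> test_fields"
  obtains D R where "\<And>x. (\<phi> has_derivative D x) (at x)" "\<And>h. continuous_on UNIV (\<lambda>x. D x h)"
    "\<And>x. norm x > R \<Longrightarrow> \<phi> x = 0" "\<And>x. norm (\<phi> x) \<le> 1"
    "\<And>x. divergence \<phi> x = (\<Sum>i\<in>UNIV. D x (axis i 1) $ i)"
proof -
  have "bounded {x. \<phi> x \<noteq> 0}"
    using assms compact_imp_bounded bounded_subset closure_subset unfolding test_fields_def by blast
  then obtain R where "\<And>x. \<phi> x \<noteq> 0 \<Longrightarrow> norm x \<le> R" unfolding bounded_iff by auto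
  then show ?thesis
    using assms that[of "\<lambda>x. frechet_derivative \<phi> (at x)" R] frechet_derivative_works
    unfolding test_fields_def divergence_def by (auto simp: not_less[symmetric])
qed

lemma divergence_props:
  assumes "\<phi> \<in> test_fields"
  obtains R B where "continuous_on UNIV (divergence \<phi>)" "\<And>x. norm x > R \<Longrightarrow> divergence \<phi> x = 0"
    "B > 0" "\<And>x. \<bar>divergence \<phi> x\<bar> \<le> B" "\<And>x. norm x > R \<Longrightarrow> \<phi> x = 0"
proof -
  obtain D R where D: "\<And>x. (\<phi> has_derivative D x) (at x)" "\<And>h. continuous_on UNIV (\<lambda>x. D x h)"
    "\<And>x. norm x > R \<Longrightarrow> \<phi> x = 0" "\<And>x. divergence \<phi> x = (\<Sum>i\<in>UNIV. D x (axis i 1) $ i)"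
    by (rule test_fieldsE[OF assms]) blast
  have c: "continuous_on UNIV (divergence \<phi>)"
    unfolding D(4)[abs_def] by (intro continuous_intros D(2))
  have z: "divergence \<phi> x = 0" if "norm x > R" for x
    unfolding D(4) using has_derivative_vanishing[OF D(1) D(3) that] by simp
  obtain B where "B > 0" "\<And>x. norm (divergence \<phi> x) \<le> B"
    using cts_vanishing_bounded[OF c z] by blast
  with that[of R B] c z D(3) show ?thesis by auto
qed

lemma divergence_measurable: "\<phi> \<in> test_fields \<Longrightarrow> divergence \<phi> \<in> borel_measurable borel"
  by (rule divergence_props) (auto intro: borel_measurable_continuous_onI)

lemma divergence_measurable_lebesgue: "\<phi> \<in> test_fields \<Longrightarrow> divergence \<phi> \<in> borel_measurable lebesgue"
  by (intro measurable_completion) (simp add: divergence_measurable)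

lemma divergence_integrable: "\<phi> \<in> test_fields \<Longrightarrow> integrable lborel (divergence \<phi>)"
  by (rule divergence_props) (auto intro: cts_vanishing_integrable)

lemma integrable_mult_divergence:
  assumes f: "integrable lebesgue f" and \<phi>: "\<phi> \<in> test_fields"
  shows "integrable lebesgue (\<lambda>x. f x * divergence \<phi> x)"
proof -
  obtain B where B: "\<And>x. \<bar>divergence \<phi> x\<bar> \<le> B" "B > 0" by (rule divergence_props[OF \<phi>]) blast
  note [measurable] = divergence_measurable_lebesgue[OF \<phi>] borel_measurable_integrable[OF f]
  show ?thesis
    by (rule Bochner_Integration.integrable_bound[of _ "\<lambda>x. B * f x"])
      (use f B in \<open>auto simp: abs_mult mult.commute[of B] intro!: mult_left_mono intro: order_trans[OF B(1)]\<close>)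
qed

text \<open>\<open>TV\<close> pairs on \<open>lebesgue\<close>, whereas Fubini and translations are
  applied on \<open>lborel\<close>. For Borel integrands the completion changes neither
  integrability nor the integral.\<close>

lemma
  assumes [measurable]: "v \<in> borel_measurable borel" and \<phi>: "\<phi> \<in> test_fields"
  shows integral_divergence_lborel:
      "(\<integral>x. v x * divergence \<phi> x \<partial>lebesgue) = (\<integral>x. v x * divergence \<phi> x \<partial>lborel)"
    and integrable_divergence_lborel:
      "integrable lborel v \<Longrightarrow> integrable lborel (\<lambda>x. v x * divergence \<phi> x)"
proof -
  note [measurable] = divergence_measurable[OF \<phi>]
  have m: "(\<lambda>x. v x * divergence \<phi> x) \<in> borel_measurable lborel" by measurable
  show "(\<integral>x. v x * divergence \<phi> x \<partial>lebesgue) = (\<integral>x. v x * divergence \<phi> x \<partial>lborel)"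
    by (rule integral_completion[OF m])
  show "integrable lborel v \<Longrightarrow> integrable lborel (\<lambda>x. v x * divergence \<phi> x)"
    using integrable_mult_divergence[OF _ \<phi>, of v] integrable_completion[OF m] integrable_completion[of v lborel]
    by simp
qed

lemma test_fields_uminus: "\<phi> \<in> test_fields \<Longrightarrow> (\<lambda>x. - \<phi> x) \<in> test_fields"
  and divergence_uminus: "\<phi> \<in> test_fields \<Longrightarrow> divergence (\<lambda>x. - \<phi> x) x = - divergence \<phi> x"
proof -
  assume "\<phi> \<in> test_fields"
  then obtain D R where D: "\<And>x. (\<phi> has_derivative D x) (at x)" "\<And>h. continuous_on UNIV (\<lambda>x. D x h)"
    "\<And>x. norm x > R \<Longrightarrow> \<phi> x = 0" "\<And>x. norm (\<phi> x) \<le> 1"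
    and div: "\<And>x. divergence \<phi> x = (\<Sum>i\<in>UNIV. D x (axis i 1) $ i)"
    by (rule test_fieldsE) blast
  have 1: "((\<lambda>x. - \<phi> x) has_derivative (\<lambda>h. - D x h)) (at x)" for x
    by (intro derivative_intros D(1))
  have 2: "continuous_on UNIV (\<lambda>x. - D x h)" for h
    by (intro continuous_intros D(2))
  have 3: "- \<phi> x = 0" if "norm x > R" for x using D(3) that by simp
  have 4: "norm (- \<phi> x) \<le> 1" for x using D(4) by simp
  note * = test_fieldsI[OF 1 2 3 4]
  show "(\<lambda>x. - \<phi> x) \<in> test_fields" by (rule *)
  show "divergence (\<lambda>x. - \<phi> x) x = - divergence \<phi> x"
    using *(2) by (simp add: div sum_negf)
qed

lemma test_fields_translate: "\<phi> \<in> test_fields \<Longrightarrow> (\<lambda>x. \<phi> (a + x)) \<in> test_fields"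
  and divergence_translate: "\<phi> \<in> test_fields \<Longrightarrow> divergence (\<lambda>x. \<phi> (a + x)) x = divergence \<phi> (a + x)"
proof -
  assume "\<phi> \<in> test_fields"
  then obtain D R where D: "\<And>x. (\<phi> has_derivative D x) (at x)" "\<And>h. continuous_on UNIV (\<lambda>x. D x h)"
    "\<And>x. norm x > R \<Longrightarrow> \<phi> x = 0" "\<And>x. norm (\<phi> x) \<le> 1"
    and div: "\<And>x. divergence \<phi> x = (\<Sum>i\<in>UNIV. D x (axis i 1) $ i)"
    by (rule test_fieldsE) blast
  have 1: "((\<lambda>x. \<phi> (a + x)) has_derivative D (a + x)) (at x)" for x
  proof -
    have "((\<lambda>x. a + x) has_derivative (\<lambda>h. h)) (at x)" by (auto intro!: derivative_eq_intros)
    from has_derivative_compose[OF this D(1)] show ?thesis by simp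
  qed
  have 2: "continuous_on UNIV (\<lambda>x. D (a + x) h)" for h
    by (rule continuous_on_compose2[OF D(2)[of h]]) (auto intro!: continuous_intros)
  have 3: "\<phi> (a + x) = 0" if "norm x > R + norm a" for x
  proof (rule D(3))
    have "norm x \<le> norm (a + x) + norm a" by (metis add_diff_cancel_left' norm_triangle_ineq4)
    then show "R < norm (a + x)" using that by simp
  qed
  note * = test_fieldsI[OF 1 2 3 D(4)]
  show "(\<lambda>x. \<phi> (a + x)) \<in> test_fields" "divergence (\<lambda>x. \<phi> (a + x)) x = divergence \<phi> (a + x)"
    using * by (auto simp: div)
qed

text \<open>Each product of \<open>g\<close> with a component of \<phi> vanishes outside a ball, so
  its partial derivative in the matching coordinate direction integrates to 0. The product rule and
  summation over the coordinates give the formula.\<close>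

lemma integral_by_parts:
  assumes g: "\<And>x. (g has_derivative (\<lambda>h. G x \<bullet> h)) (at x)" and G: "continuous_on UNIV G"
    and \<phi>: "\<phi> \<in> test_fields"
  shows "(\<integral>x. g x * divergence \<phi> x \<partial>lborel) = - (\<integral>x. G x \<bullet> \<phi> x \<partial>lborel)"
proof -
  from \<phi> obtain D R where D: "\<And>x. (\<phi> has_derivative D x) (at x)" "\<And>h. continuous_on UNIV (\<lambda>x. D x h)"
    "\<And>x. norm x > R \<Longrightarrow> \<phi> x = 0" "\<And>x. norm (\<phi> x) \<le> 1"
    and div: "\<And>x. divergence \<phi> x = (\<Sum>i\<in>UNIV. D x (axis i 1) $ i)"
    by (rule test_fieldsE) blast
  have cg: "continuous_on UNIV g"
    using g by (rule has_derivative_continuous_on)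
  have cp: "continuous_on UNIV \<phi>"
    using D(1) by (rule has_derivative_continuous_on)
  have zD: "D x = (\<lambda>h. 0)" if "norm x > R" for x
    using has_derivative_vanishing[OF D(1) D(3) that] by simp
  have F: "((\<lambda>x. g x * \<phi> x $ i) has_derivative (\<lambda>h. g x * D x h $ i + (G x \<bullet> h) * \<phi> x $ i)) (at x)" for i x
    by (rule has_derivative_eq_rhs, rule has_derivative_mult[OF g
      bounded_linear.has_derivative[OF bounded_linear_vec_nth D(1)]]) auto
  have c: "continuous_on UNIV (\<lambda>x. g x * D x (axis i 1) $ i)"
     "continuous_on UNIV (\<lambda>x. (G x \<bullet> axis i 1) * \<phi> x $ i)" for i
    by (intro continuous_intros cg cp D(2) G)+
  have i: "integrable lborel (\<lambda>x. g x * D x (axis i 1) $ i)"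
     "integrable lborel (\<lambda>x. (G x \<bullet> axis i 1) * \<phi> x $ i)" for i
    by (rule cts_vanishing_integrable[OF c(1), of R] cts_vanishing_integrable[OF c(2), of R], simp add: zD D(3))+
  have 0: "(\<integral>x. g x * D x (axis i 1) $ i \<partial>lborel) + (\<integral>x. (G x \<bullet> axis i 1) * \<phi> x $ i \<partial>lborel) = 0" for i
    using integral_derivative_zero[OF F[of i], of "axis i 1" R] D(3) i[of i] c[of i]
    by (simp add: continuous_on_add)
  have "(\<integral>x. g x * divergence \<phi> x \<partial>lborel) + (\<integral>x. G x \<bullet> \<phi> x \<partial>lborel)
    = (\<integral>x. (\<Sum>i\<in>UNIV. g x * D x (axis i 1) $ i) \<partial>lborel) + (\<integral>x. (\<Sum>i\<in>UNIV. (G x \<bullet> axis i 1) * \<phi> x $ i) \<partial>lborel)"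
    by (simp add: div sum_distrib_left inner_axis inner_vec_def[of "G _" "\<phi> _"])
  also have "\<dots> = (\<Sum>i\<in>UNIV. (\<integral>x. g x * D x (axis i 1) $ i \<partial>lborel) + (\<integral>x. (G x \<bullet> axis i 1) * \<phi> x $ i \<partial>lborel))"
    using i by (simp add: sum.distrib)
  finally show ?thesis using 0 by simp
qed

section \<open>Total variation of smooth functions\<close>

lemma TV_upper: "\<phi> \<in> test_fields \<Longrightarrow> ennreal (\<integral>x. v x * divergence \<phi> x \<partial>lebesgue) \<le> TV v"
  unfolding TV_def by (rule SUP_upper)

lemma TV_least:
  "(\<And>\<phi>. \<phi> \<in> test_fields \<Longrightarrow> ennreal (\<integral>x. v x * divergence \<phi> x \<partial>lebesgue) \<le> B) \<Longrightarrow> TV v \<le> B"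
  unfolding TV_def by (rule SUP_least)

lemma TV_cong_AE:
  assumes [measurable]: "v \<in> borel_measurable lebesgue" "w \<in> borel_measurable lebesgue"
    and "AE x in lebesgue. v x = w x"
  shows "TV v = TV w"
proof -
  have "(\<integral>x. v x * divergence \<phi> x \<partial>lebesgue) = (\<integral>x. w x * divergence \<phi> x \<partial>lebesgue)"
    if "\<phi> \<in> test_fields" for \<phi>
  proof (rule integral_cong_AE)
    note [measurable] = divergence_measurable_lebesgue[OF that]
    show "(\<lambda>x. v x * divergence \<phi> x) \<in> borel_measurable lebesgue" by measurable
    show "(\<lambda>x. w x * divergence \<phi> x) \<in> borel_measurable lebesgue" by measurable
  qed (use assms(3) in auto)
  then show ?thesis unfolding TV_def by simp
qed

lemma TV_uminus: "TV (\<lambda>x. - v x) = TV v"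
proof -
  have "TV (\<lambda>x. - w x) \<le> TV w" for w
  proof (rule TV_least)
    fix \<phi> assume "\<phi> \<in> test_fields"
    then show "ennreal (\<integral>x. - w x * divergence \<phi> x \<partial>lebesgue) \<le> TV w"
      using TV_upper[OF test_fields_uminus, of \<phi> w] by (simp add: divergence_uminus)
  qed
  from this[of v] this[of "\<lambda>x. - v x"] show ?thesis by simp
qed

lemma TV_scale:
  assumes "c \<ge> 0"
  shows "TV (\<lambda>x. c * v x) = ennreal c * TV v"
  using assms unfolding TV_def by (simp add: SUP_mult_left_ennreal ennreal_mult' mult.assoc)

lemma ennreal_add_le: "ennreal (a + b) \<le> ennreal a + ennreal b"
proof (cases "a \<ge> 0 \<and> b \<ge> 0")
  case False
  then have "a + b \<le> a \<or> a + b \<le> b" by auto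
  then show ?thesis
    by (metis add.commute add_increasing ennreal_leI order_trans zero_le order_refl)
qed simp

lemma TV_add:
  assumes "integrable lebesgue v" "integrable lebesgue w"
  shows "TV (\<lambda>x. v x + w x) \<le> TV v + TV w"
proof (rule TV_least)
  fix \<phi> assume \<phi>: "\<phi> \<in> test_fields"
  have "ennreal (\<integral>x. (v x + w x) * divergence \<phi> x \<partial>lebesgue)
      = ennreal ((\<integral>x. v x * divergence \<phi> x \<partial>lebesgue) + (\<integral>x. w x * divergence \<phi> x \<partial>lebesgue))"
    using assms \<phi> by (simp add: distrib_right integrable_mult_divergence)
  also have "\<dots> \<le> ennreal (\<integral>x. v x * divergence \<phi> x \<partial>lebesgue) + ennreal (\<integral>x. w x * divergence \<phi> x \<partial>lebesgue)"
    by (rule ennreal_add_le)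
  also have "\<dots> \<le> TV v + TV w"
    by (intro add_mono TV_upper \<phi>)
  finally show "ennreal (\<integral>x. (v x + w x) * divergence \<phi> x \<partial>lebesgue) \<le> TV v + TV w" .
qed

text \<open>\<open>TV\<close> is a supremum of pairings, so convergence of each single pairing
  suffices. In this weak form the hypothesis can be supplied both by L^1 convergence and by
  dominated pointwise convergence.\<close>

lemma TV_lsc:
  assumes "\<And>\<phi>. \<phi> \<in> test_fields \<Longrightarrow>
    (\<lambda>n. \<integral>x. V n x * divergence \<phi> x \<partial>lebesgue) \<longlonglongrightarrow> (\<integral>x. v x * divergence \<phi> x \<partial>lebesgue)"
  shows "TV v \<le> liminf (\<lambda>n. TV (V n))"
proof (rule TV_least)
  fix \<phi> assume \<phi>: "\<phi> \<in> test_fields"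
  have "ennreal (\<integral>x. v x * divergence \<phi> x \<partial>lebesgue)
      = liminf (\<lambda>n. ennreal (\<integral>x. V n x * divergence \<phi> x \<partial>lebesgue))"
    using lim_imp_Liminf[OF _ tendsto_ennrealI[OF assms[OF \<phi>]]] by simp
  also have "\<dots> \<le> liminf (\<lambda>n. TV (V n))"
    by (intro Liminf_mono always_eventually allI TV_upper \<phi>)
  finally show "ennreal (\<integral>x. v x * divergence \<phi> x \<partial>lebesgue) \<le> liminf (\<lambda>n. TV (V n))" .
qed

text \<open>The tail infima increase, so the sum of their suprema is the supremum of their sums, and
  each of these sums lies below \<open>a n + b n\<close>.\<close>

lemma liminf_add_le_ennreal:
  fixes a b :: "nat \<Rightarrow> ennreal"
  assumes "\<And>n. a n + b n \<le> B"
  shows "liminf a + liminf b \<le> B"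
proof -
  have "liminf a + liminf b = (SUP n. (INF m\<in>{n..}. a m) + (INF m\<in>{n..}. b m))"
    unfolding liminf_SUP_INF
    by (rule ennreal_SUP_add[symmetric]) (auto intro!: incseq_SucI INF_superset_mono)
  also have "\<dots> \<le> B"
  proof (rule SUP_least)
    fix n
    have "(INF m\<in>{n..}. a m) + (INF m\<in>{n..}. b m) \<le> a n + b n"
      by (intro add_mono INF_lower) auto
    then show "(INF m\<in>{n..}. a m) + (INF m\<in>{n..}. b m) \<le> B"
      using assms[of n] by (rule order_trans)
  qed
  finally show ?thesis .
qed

text \<open>Serves to carry a truncation inequality from approximating functions to their limit,
  with both pieces converging at once.\<close>

lemma TV_add_lsc:
  assumes "\<And>\<phi>. \<phi> \<in> test_fields \<Longrightarrow>
    (\<lambda>n. \<integral>x. V n x * divergence \<phi> x \<partial>lebesgue) \<longlonglongrightarrow> (\<integral>x. v x * divergence \<phi> x \<partial>lebesgue)"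
    and "\<And>\<phi>. \<phi> \<in> test_fields \<Longrightarrow>
    (\<lambda>n. \<integral>x. W n x * divergence \<phi> x \<partial>lebesgue) \<longlonglongrightarrow> (\<integral>x. w x * divergence \<phi> x \<partial>lebesgue)"
    and "\<And>n. TV (V n) + TV (W n) \<le> B"
  shows "TV v + TV w \<le> B"
  using add_mono[OF TV_lsc[of V v] TV_lsc[of W w]] liminf_add_le_ennreal[of "\<lambda>n. TV (V n)" "\<lambda>n. TV (W n)" B] assms
  by (meson order_trans)

text \<open>After integration by parts, Cauchy-Schwarz and the bound 1 on the test field estimate
  the integrand by the norm of the gradient.\<close>

lemma TV_le_integral_gradient:
  assumes g: "\<And>x. (g has_derivative (\<lambda>h. G x \<bullet> h)) (at x)" and G: "continuous_on UNIV G"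
    and z: "\<And>x. norm x > R \<Longrightarrow> G x = 0"
  shows "TV g \<le> ennreal (\<integral>x. norm (G x) \<partial>lborel)"
proof (rule TV_least)
  fix \<phi> assume \<phi>: "\<phi> \<in> test_fields"
  then obtain D where D: "\<And>x. (\<phi> has_derivative D x) (at x)" "\<And>x. norm (\<phi> x) \<le> 1"
    by (rule test_fieldsE) blast
  have cp: "continuous_on UNIV \<phi>" using D(1) by (rule has_derivative_continuous_on)
  have cg: "continuous_on UNIV g" using g by (rule has_derivative_continuous_on)
  have "(\<integral>x. g x * divergence \<phi> x \<partial>lebesgue) = (\<integral>x. - (G x \<bullet> \<phi> x) \<partial>lborel)"
    using integral_divergence_lborel[OF borel_measurable_continuous_onI[OF cg] \<phi>] integral_by_parts[OF g G \<phi>] by simp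
  also have "\<dots> \<le> (\<integral>x. norm (G x) \<partial>lborel)"
  proof (rule integral_mono)
    show "integrable lborel (\<lambda>x. - (G x \<bullet> \<phi> x))"
      by (rule cts_vanishing_integrable[of _ R]) (auto intro!: continuous_intros cp G simp: z)
    show "integrable lborel (\<lambda>x. norm (G x))"
      by (rule cts_vanishing_integrable[of _ R]) (auto intro!: continuous_intros G simp: z)
    show "- (G x \<bullet> \<phi> x) \<le> norm (G x)" for x
      using norm_cauchy_schwarz[of "G x" "- \<phi> x"] mult_left_mono[OF D(2)[of x] norm_ge_zero[of "G x"]] by simp
  qed
  finally show "ennreal (\<integral>x. g x * divergence \<phi> x \<partial>lebesgue) \<le> ennreal (\<integral>x. norm (G x) \<partial>lborel)"
    by (rule ennreal_leI)
qed

text \<open>The supremum is approached by fields close to the negative normalised gradient. The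
  second derivative \<open>H\<close> makes these fields C^1; their pairings with \<open>g\<close>
  are integrals of |G|^2 / s, which are dominated by |G| and converge to its integral.\<close>

lemma integral_gradient_le_TV:
  assumes g: "\<And>x. (g has_derivative (\<lambda>h. G x \<bullet> h)) (at x)"
    and G: "\<And>x. (G has_derivative H x) (at x)" and H: "\<And>h. continuous_on UNIV (\<lambda>x. H x h)"
    and z: "\<And>x. norm x > R \<Longrightarrow> G x = 0"
  shows "ennreal (\<integral>x. norm (G x) \<partial>lborel) \<le> TV g"
proof -
  have cg: "continuous_on UNIV g" using g by (rule has_derivative_continuous_on)
  have cG: "continuous_on UNIV G" using G by (rule has_derivative_continuous_on)
  note [measurable] = borel_measurable_continuous_onI[OF cG]
  have iG: "integrable lborel (\<lambda>x. norm (G x))"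
    by (rule cts_vanishing_integrable[of _ R]) (auto intro!: continuous_intros cG simp: z)
  \<comment> \<open>The smooth fields \<open>\<phi> n\<close> below approximate the optimal but possibly discontinuous field \<open>- G / |G|\<close>.\<close>
  define s where "s n x = sqrt ((1 / real (Suc n))\<^sup>2 + G x \<bullet> G x)" for n x
  have s: "s n x > 0" "norm (G x) \<le> s n x" for n x
  proof -
    have "0 < (1 / real (Suc n))\<^sup>2 + G x \<bullet> G x" by (intro add_pos_nonneg) auto
    then show "s n x > 0" unfolding s_def by simp
    show "norm (G x) \<le> s n x" unfolding s_def norm_eq_sqrt_inner by simp
  qed
  define \<phi> where "\<phi> n x = - (inverse (s n x) *\<^sub>R G x)" for n x
  \<comment> \<open>The cubic term comes from the derivative of 1 / s, which is -(G . H h) /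
    s^3.\<close>
  define D where "D n x h = - (inverse (s n x) *\<^sub>R H x h - ((G x \<bullet> H x h) * inverse (s n x) ^ 3) *\<^sub>R G x)" for n x h
  have ds: "((\<lambda>x. s n x) has_derivative (\<lambda>h. (G x \<bullet> H x h) * inverse (s n x))) (at x)" for n x
  proof -
    have "0 < (1 / real (Suc n))\<^sup>2 + G x \<bullet> G x" by (intro add_pos_nonneg) auto
    then show ?thesis unfolding s_def
      by (auto intro!: derivative_eq_intros G simp: inner_commute divide_simps fun_eq_iff)
  qed
  have dphi: "(\<phi> n has_derivative D n x) (at x)" for n x
    unfolding \<phi>_def[abs_def] D_def using s(1)[of n x]
    by (auto intro!: derivative_eq_intros ds G simp: fun_eq_iff power3_eq_cube power2_eq_square algebra_simps)
  have cs: "continuous_on UNIV (s n)" for n using ds by (rule has_derivative_continuous_on)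
  have cD: "continuous_on UNIV (\<lambda>x. D n x h)" for n h
    unfolding D_def using s(1)[of n]
    by (intro continuous_intros H cG cs) (auto simp: less_imp_neq[symmetric])
  have n1: "norm (\<phi> n x) \<le> 1" for n x
    using s(2)[where x=x and n=n] s(1)[of n x] by (simp add: \<phi>_def divide_simps)
  have zphi: "\<phi> n x = 0" if "norm x > R" for n x using z[OF that] by (simp add: \<phi>_def)
  have tf: "\<phi> n \<in> test_fields" for n by (rule test_fieldsI(1)[OF dphi cD zphi n1])
  have "ennreal (\<integral>x. inverse (s n x) * (norm (G x))\<^sup>2 \<partial>lborel) \<le> TV g" for n
    using TV_upper[OF tf[of n], of g] integral_divergence_lborel[OF borel_measurable_continuous_onI[OF cg] tf[of n]]
      integral_by_parts[OF g cG tf[of n]] by (simp add: \<phi>_def power2_norm_eq_inner)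
  moreover have "(\<lambda>n. \<integral>x. inverse (s n x) * (norm (G x))\<^sup>2 \<partial>lborel) \<longlonglongrightarrow> (\<integral>x. norm (G x) \<partial>lborel)"
  proof (rule integral_dominated_convergence[OF _ _ iG])
    show "AE x in lborel. (\<lambda>n. inverse (s n x) * (norm (G x))\<^sup>2) \<longlonglongrightarrow> norm (G x)"
    proof (rule AE_I2)
      fix x
      show "(\<lambda>n. inverse (s n x) * (norm (G x))\<^sup>2) \<longlonglongrightarrow> norm (G x)"
      proof (cases "G x = 0")
        case False
        have "(\<lambda>n. s n x) \<longlonglongrightarrow> sqrt (0\<^sup>2 + G x \<bullet> G x)"
          unfolding s_def by (intro tendsto_intros LIMSEQ_Suc[OF lim_1_over_n])
        then have "(\<lambda>n. inverse (s n x) * (norm (G x))\<^sup>2) \<longlonglongrightarrow> inverse (norm (G x)) * (norm (G x))\<^sup>2"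
          using False by (intro tendsto_intros) (auto simp: norm_eq_sqrt_inner)
        moreover have "inverse (norm (G x)) * (norm (G x))\<^sup>2 = norm (G x)"
          using False by (simp add: power2_eq_square)
        ultimately show ?thesis by (simp only:)
      qed simp
    qed
    show "AE x in lborel. norm (inverse (s n x) * (norm (G x))\<^sup>2) \<le> norm (G x)" for n
    proof (rule AE_I2)
      fix x
      have "norm (G x) * norm (G x) \<le> s n x * norm (G x)"
        using s by (intro mult_right_mono) auto
      then show "norm (inverse (s n x) * (norm (G x))\<^sup>2) \<le> norm (G x)"
        using s(1)[of n x] by (simp add: abs_mult power2_eq_square divide_simps mult.commute)
    qed
  qed (auto simp: s_def)
  ultimately show ?thesis
    by (intro LIMSEQ_le_const2[OF tendsto_ennrealI]) auto
qed

text \<open>The two pieces have gradients b'(g) G and (1 - b'(g)) G. Both factors are nonnegative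
  and add up to 1, so the norms of the gradients add up to |G| at every point.\<close>

lemma TV_split_smooth:
  assumes g: "\<And>x. (g has_derivative (\<lambda>h. G x \<bullet> h)) (at x)"
    and G: "\<And>x. (G has_derivative H x) (at x)" and H: "\<And>h. continuous_on UNIV (\<lambda>x. H x h)"
    and z: "\<And>x. norm x > R \<Longrightarrow> G x = 0"
    and b: "\<And>t. (b has_real_derivative b' t) (at t)" and cb': "continuous_on UNIV b'"
    and b': "\<And>t. 0 \<le> b' t" "\<And>t. b' t \<le> 1"
  shows "TV (\<lambda>x. b (g x)) + TV (\<lambda>x. g x - b (g x)) \<le> TV g"
proof -
  have cg: "continuous_on UNIV g" using g by (rule has_derivative_continuous_on)
  have cG: "continuous_on UNIV G" using G by (rule has_derivative_continuous_on)
  have cbg: "continuous_on UNIV (\<lambda>x. b' (g x))"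
    using continuous_on_compose2[OF cb' cg] by simp
  have d1: "((\<lambda>x. b (g x)) has_derivative (\<lambda>h. (b' (g x) *\<^sub>R G x) \<bullet> h)) (at x)" for x
    using has_derivative_compose[OF g, of b "(*) (b' (g x))"] b unfolding has_field_derivative_def by simp
  have d2: "((\<lambda>x. g x - b (g x)) has_derivative (\<lambda>h. ((1 - b' (g x)) *\<^sub>R G x) \<bullet> h)) (at x)" for x
    by (rule has_derivative_eq_rhs[OF has_derivative_diff[OF g d1]]) (simp add: algebra_simps)
  have i: "integrable lborel (\<lambda>x. norm (b' (g x) *\<^sub>R G x))" "integrable lborel (\<lambda>x. norm ((1 - b' (g x)) *\<^sub>R G x))"
    by (rule cts_vanishing_integrable[of _ R], auto intro!: continuous_intros cG cbg simp: z)+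
  have "TV (\<lambda>x. b (g x)) + TV (\<lambda>x. g x - b (g x))
    \<le> ennreal (\<integral>x. norm (b' (g x) *\<^sub>R G x) \<partial>lborel) + ennreal (\<integral>x. norm ((1 - b' (g x)) *\<^sub>R G x) \<partial>lborel)"
    by (intro add_mono TV_le_integral_gradient[OF d1, of R] TV_le_integral_gradient[OF d2, of R])
      (auto intro!: continuous_intros cG cbg simp: z)
  also have "\<dots> = ennreal (\<integral>x. norm (b' (g x) *\<^sub>R G x) + norm ((1 - b' (g x)) *\<^sub>R G x) \<partial>lborel)"
    using i by (simp add: ennreal_plus[symmetric] del: ennreal_plus norm_scaleR)
  also have "\<dots> = ennreal (\<integral>x. norm (G x) \<partial>lborel)"
    unfolding norm_scaleR distrib_right[symmetric] using b' by simp
  also have "\<dots> \<le> TV g" by (rule integral_gradient_le_TV[OF g G H z])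
  finally show ?thesis .
qed

section \<open>Approximation and convolution\<close>

text \<open>Measurability provides continuous functions converging to \<open>f\<close> almost
  everywhere, but without an integrable majorant. Clamping the values and cutting off in space
  supplies one: first M is chosen so that the cut \<open>f\<close> is close to \<open>f\<close>,
  then n so that the cut approximant is close to the cut \<open>f\<close>.\<close>

lemma integrable_approx_continuous:
  fixes f :: "'a::euclidean_space \<Rightarrow> real"
  assumes f: "integrable lborel f" and e: "e > 0"
  obtains g R where "continuous_on UNIV g" "\<And>x. norm x > R \<Longrightarrow> g x = 0" "(\<integral>x. \<bar>f x - g x\<bar> \<partial>lborel) < e"
proof -
  note [measurable] = borel_measurable_integrable[OF f]
  have "f \<in> borel_measurable lebesgue" by (rule measurable_completion) measurable
  then have "f measurable_on UNIV"
    using measurable_on_iff_borel_measurable[of UNIV f] by (simp add: lebesgue_on_UNIV_eq)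
  then obtain N g where N: "negligible N" and g: "\<And>n::nat. continuous_on UNIV (g n)"
    and lim: "\<And>x. x \<notin> N \<Longrightarrow> (\<lambda>n. g n x) \<longlonglongrightarrow> f x"
    unfolding measurable_on_def by auto
  have [measurable]: "g n \<in> borel_measurable borel" for n
    by (rule borel_measurable_continuous_onI[OF g])
  \<comment> \<open>\<open>c M\<close> clamps values to [-M, M]; \<open>cut M\<close> is a
    continuous cut-off equal to 1 on the ball of radius M and to 0 outside radius M + 1.\<close>
  define c where "c M s = max (- real M) (min (real M) s)" for M s
  define cut where "cut M x = max 0 (min 1 (real M + 1 - norm x))" for M and x :: 'a
  define F where "F M x = c M (f x) * cut M x" for M x
  define h where "h M n x = c M (g n x) * cut M x" for M n x
  have [measurable]: "c M \<in> borel_measurable borel" "cut M \<in> borel_measurable borel" for M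
    unfolding c_def[abs_def] cut_def[abs_def] by measurable
  have cb: "\<bar>c M s\<bar> \<le> \<bar>s\<bar>" "\<bar>c M s\<bar> \<le> real M" for M s unfolding c_def by auto
  have chi: "0 \<le> cut M x" "cut M x \<le> 1" for M x unfolding cut_def by auto
  have chi0: "cut M x = 0" if "norm x > real M + 1" for M x using that unfolding cut_def by auto
  have hb: "\<bar>c M s * cut M x\<bar> \<le> real M * indicator (cball 0 (real M + 1)) x" for M s x
  proof (cases "norm x > real M + 1")
    case False
    have "\<bar>c M s * cut M x\<bar> \<le> real M * 1"
      unfolding abs_mult using cb chi[of M x] by (intro mult_mono) auto
    then show ?thesis using False by simp
  qed (simp add: chi0)
  have iM: "integrable lborel (\<lambda>x::'a. 2 * real M * indicator (cball 0 (real M + 1)) x :: real)" for M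
    using emeasure_bounded_finite[OF bounded_cball, of "0::'a" "real M + 1"]
    by (intro integrable_mult_right integrable_real_indicator) auto
  have "(\<lambda>M. \<integral>x. \<bar>f x - F M x\<bar> \<partial>lborel) \<longlonglongrightarrow> integral\<^sup>L lborel (\<lambda>x::'a. 0)"
  proof (rule integral_dominated_convergence)
    show "integrable lborel (\<lambda>x. 2 * \<bar>f x\<bar>)" using f by simp
    show "AE x in lborel. (\<lambda>M. \<bar>f x - F M x\<bar>) \<longlonglongrightarrow> 0"
    proof (rule AE_I2)
      fix x
      obtain M0 :: nat where M0: "real M0 > max \<bar>f x\<bar> (norm x)" using reals_Archimedean2 by blast
      have "\<bar>f x - F M x\<bar> = 0" if "M \<ge> M0" for M
      proof -
        have "real M \<ge> real M0" using that by simp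
        then have "c M (f x) = f x" "cut M x = 1" unfolding c_def cut_def using M0 by auto
        then show ?thesis unfolding F_def by simp
      qed
      then show "(\<lambda>M. \<bar>f x - F M x\<bar>) \<longlonglongrightarrow> 0"
        by (intro tendsto_eventually) (auto simp: eventually_sequentially)
    qed
    have "\<bar>F M x\<bar> \<le> \<bar>f x\<bar> * 1" for M x
      unfolding F_def abs_mult using cb chi[of M x] by (intro mult_mono) auto
    then have "\<bar>f x - F M x\<bar> \<le> 2 * \<bar>f x\<bar>" for M x
      by (metis abs_triangle_ineq4 add_left_mono mult.right_neutral mult_2 order_trans)
    then show "AE x in lborel. norm \<bar>f x - F M x\<bar> \<le> 2 * \<bar>f x\<bar>" for M by simp
  qed (auto simp: F_def)
  then have "eventually (\<lambda>M. (\<integral>x. \<bar>f x - F M x\<bar> \<partial>lborel) < e / 2) sequentially"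
    using e by (intro order_tendstoD(2)) auto
  then obtain M where M: "(\<integral>x. \<bar>f x - F M x\<bar> \<partial>lborel) < e / 2"
    by (auto simp: eventually_sequentially)
  have "(\<lambda>n. \<integral>x. \<bar>F M x - h M n x\<bar> \<partial>lborel) \<longlonglongrightarrow> integral\<^sup>L lborel (\<lambda>x::'a. 0)"
  proof (rule integral_dominated_convergence[OF _ _ iM])
    have "N \<in> null_sets lebesgue" using N negligible_iff_null_sets by blast
    then have "AE x in lebesgue. x \<notin> N" by (rule AE_not_in)
    then have "AE x in lebesgue. (\<lambda>n. \<bar>F M x - h M n x\<bar>) \<longlonglongrightarrow> 0"
    proof eventually_elim
      case (elim x)
      have "(\<lambda>n. \<bar>F M x - h M n x\<bar>) \<longlonglongrightarrow> \<bar>F M x - F M x\<bar>"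
        unfolding F_def h_def c_def by (intro tendsto_intros lim elim)
      then show ?case by simp
    qed
    then show "AE x in lborel. (\<lambda>n. \<bar>F M x - h M n x\<bar>) \<longlonglongrightarrow> 0"
      by (rule AE_completion_iff[THEN iffD1, rotated])
    have "\<bar>F M x - h M n x\<bar> \<le> 2 * real M * indicator (cball 0 (real M + 1)) x" for n x
      using hb[of M "f x" x] hb[of M "g n x" x] abs_triangle_ineq4[of "F M x" "h M n x"]
      unfolding F_def h_def by simp
    then show "AE x in lborel. norm \<bar>F M x - h M n x\<bar> \<le> 2 * real M * indicator (cball 0 (real M + 1)) x" for n
      by simp
  qed (auto simp: F_def h_def)
  then have "eventually (\<lambda>n. (\<integral>x. \<bar>F M x - h M n x\<bar> \<partial>lborel) < e / 2) sequentially"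
    using e by (intro order_tendstoD(2)) auto
  then obtain n where n: "(\<integral>x. \<bar>F M x - h M n x\<bar> \<partial>lborel) < e / 2"
    by (auto simp: eventually_sequentially)
  have ch: "continuous_on UNIV (h M n)" unfolding h_def c_def cut_def by (intro continuous_intros g)
  have zh: "h M n x = 0" if "norm x > real M + 1" for x using chi0[OF that] by (simp add: h_def)
  have ih: "integrable lborel (h M n)" by (rule cts_vanishing_integrable[OF ch zh])
  have iF: "integrable lborel (F M)"
  proof (rule Bochner_Integration.integrable_bound[OF iM[of M]])
    show "F M \<in> borel_measurable lborel" unfolding F_def[abs_def] by measurable
    have "\<bar>F M x\<bar> \<le> 2 * real M * indicator (cball 0 (real M + 1)) x" for x
      using hb[of M "f x" x] unfolding F_def by (auto split: split_indicator_asm split_indicator)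
    then show "AE x in lborel. norm (F M x) \<le> norm (2 * real M * indicator (cball 0 (real M + 1)) x)" by simp
  qed
  have "(\<integral>x. \<bar>f x - h M n x\<bar> \<partial>lborel) \<le> (\<integral>x. \<bar>f x - F M x\<bar> + \<bar>F M x - h M n x\<bar> \<partial>lborel)"
    using f ih iF by (intro integral_mono) auto
  also have "\<dots> < e" using M n f ih iF by simp
  finally show ?thesis using that[OF ch zh] by blast
qed

text \<open>A three-term estimate through a continuous \<open>g\<close> close to \<open>f\<close> in
  L^1: translation preserves the error \<open>f - g\<close>, and the uniform continuity of
  \<open>g\<close> on a ball of finite measure controls the middle term.\<close>

lemma translation_continuous_L1:
  fixes f :: "'a::euclidean_space \<Rightarrow> real"
  assumes f: "integrable lborel f" and e: "e > 0"
  obtains d where "d > 0" "\<And>y. norm y < d \<Longrightarrow> (\<integral>x. \<bar>f (x - y) - f x\<bar> \<partial>lborel) \<le> e"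
proof -
  have e3: "e / 3 > 0" using e by simp
  obtain g R where cg: "continuous_on UNIV g" and zg: "\<And>x. norm x > R \<Longrightarrow> g x = 0"
    and fg: "(\<integral>x. \<bar>f x - g x\<bar> \<partial>lborel) < e / 3"
    using integrable_approx_continuous[OF f e3] by blast
  have ig: "integrable lborel g" by (rule cts_vanishing_integrable[OF cg zg])
  note [measurable] = borel_measurable_integrable[OF f] borel_measurable_continuous_onI[OF cg]
  define m where "m = measure lborel (cball 0 (R + 1) :: 'a set)"
  have m: "m \<ge> 0" unfolding m_def by simp
  \<comment> \<open>The summand 1 keeps the denominator positive when the ball of radius R + 1 is
    null.\<close>
  have "e / (3 * (m + 1)) > 0" using e m by simp
  then obtain d where d: "d > 0" "\<And>x y. norm (x - y) < d \<Longrightarrow> norm (g x - g y) < e / (3 * (m + 1))"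
    using cts_vanishing_uniform[OF cg zg] by blast
  have tr: "integrable lborel (\<lambda>x. k (x - y))" "(\<integral>x. k (x - y) \<partial>lborel) = (\<integral>x. k x \<partial>lborel)"
    if "integrable lborel k" for k :: "'a \<Rightarrow> real" and y
    using integrable_lborel_translate[of k "- y"] integral_lborel_translate[of k "- y"] that by simp_all
  have "(\<integral>x. \<bar>f (x - y) - f x\<bar> \<partial>lborel) \<le> e" if y: "norm y < min d 1" for y
  proof -
    have "(\<integral>x. \<bar>g (x - y) - g x\<bar> \<partial>lborel) \<le> integral\<^sup>L lborel (\<lambda>x::'a. e / (3 * (m + 1)) * indicator (cball 0 (R + 1)) x)"
    proof (rule integral_mono)
      show "integrable lborel (\<lambda>x::'a. e / (3 * (m + 1)) * indicator (cball 0 (R + 1)) x)"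
        using emeasure_bounded_finite[OF bounded_cball, of "0::'a" "R + 1"]
        by (intro integrable_mult_right integrable_real_indicator) auto
      show "\<bar>g (x - y) - g x\<bar> \<le> e / (3 * (m + 1)) * indicator (cball 0 (R + 1)) x" for x
      proof (cases "x \<in> cball 0 (R + 1)")
        case True
        then show ?thesis using d(2)[of "x - y" x] y by simp
      next
        case False
        then have "norm x > R + 1" by simp
        moreover have "norm x \<le> norm (x - y) + norm y" using norm_triangle_sub[of x y] by simp
        ultimately have "norm x > R" "norm (x - y) > R" using y by auto
        then show ?thesis using zg False by simp
      qed
    qed (use tr ig in auto)
    also have "\<dots> = e / (3 * (m + 1)) * m" by (simp add: m_def)
    also have "\<dots> \<le> e / 3" using e m by (simp add: field_simps)
    finally have g3: "(\<integral>x. \<bar>g (x - y) - g x\<bar> \<partial>lborel) \<le> e / 3" .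
    have i: "integrable lborel (\<lambda>x. \<bar>f x - g x\<bar>)" using f ig by simp
    have i2: "integrable lborel (\<lambda>x. \<bar>g (x - y) - g x\<bar>)" using tr(1)[OF ig] ig by simp
    note ti = tr[OF i, of y]
    have "(\<integral>x. \<bar>f (x - y) - f x\<bar> \<partial>lborel)
      \<le> (\<integral>x. \<bar>f (x - y) - g (x - y)\<bar> + \<bar>g (x - y) - g x\<bar> + \<bar>f x - g x\<bar> \<partial>lborel)"
      using f tr(1)[OF f, of y] ti(1) i i2 by (intro integral_mono) auto
    also have "\<dots> = (\<integral>x. \<bar>f x - g x\<bar> \<partial>lborel) + (\<integral>x. \<bar>g (x - y) - g x\<bar> \<partial>lborel) + (\<integral>x. \<bar>f x - g x\<bar> \<partial>lborel)"
      using ti i i2 by simp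
    finally show ?thesis using fg g3 by simp
  qed
  with that[of "min d 1"] d(1) show ?thesis by auto
qed

text \<open>The kernel may be vector valued, because the gradient of a mollifier is convolved as
  well as the mollifier itself.\<close>

definition conv :: "('a::euclidean_space \<Rightarrow> real) \<Rightarrow> ('a \<Rightarrow> 'b) \<Rightarrow> 'a \<Rightarrow> 'b::{banach, second_countable_topology}"
  where "conv f K x = (\<integral>y. f y *\<^sub>R K (x - y) \<partial>lborel)"

lemma conv_integrable:
  fixes K :: "'a::euclidean_space \<Rightarrow> 'b::{banach, second_countable_topology}"
  assumes f: "integrable lborel f" and c: "continuous_on UNIV K" and z: "\<And>x. norm x > R \<Longrightarrow> K x = 0"
  shows "integrable lborel (\<lambda>y. f y *\<^sub>R K (x - y))"
proof -
  obtain B where B: "B > 0" "\<And>x. norm (K x) \<le> B" using cts_vanishing_bounded[OF c z] by blast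
  note [measurable] = borel_measurable_integrable[OF f] borel_measurable_continuous_onI[OF c]
  show ?thesis
    by (rule Bochner_Integration.integrable_bound[of _ "\<lambda>y. B * f y"])
      (use f B in \<open>auto simp: abs_mult mult.commute[of B] intro!: mult_left_mono intro: order_trans[OF B(2)]\<close>)
qed

lemma conv_continuous:
  fixes K :: "'a::euclidean_space \<Rightarrow> 'b::{banach, second_countable_topology}"
  assumes f: "integrable lborel f" and c: "continuous_on UNIV K" and z: "\<And>x. norm x > R \<Longrightarrow> K x = 0"
  shows "continuous_on UNIV (conv f K)"
  unfolding continuous_on_iff
proof (intro ballI allI impI)
  fix x e :: real and x0 assume "0 < (e::real)"
  define A where "A = (\<integral>y. \<bar>f y\<bar> \<partial>lborel)"
  have A: "A \<ge> 0" unfolding A_def by simp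
  \<comment> \<open>Dividing by \<open>A + 1\<close> covers the case \<open>A = 0\<close>, in which
    \<open>f\<close> vanishes almost everywhere.\<close>
  have "e / (A + 1) > 0" using \<open>0 < e\<close> A by simp
  then obtain d where d: "d > 0" "\<And>x y. norm (x - y) < d \<Longrightarrow> norm (K x - K y) < e / (A + 1)"
    using cts_vanishing_uniform[OF c z] by blast
  have "dist (conv f K x') (conv f K x0) < e" if "dist x' x0 < d" for x'
  proof -
    have "norm (conv f K x' - conv f K x0) = norm (\<integral>y. f y *\<^sub>R (K (x' - y) - K (x0 - y)) \<partial>lborel)"
      unfolding conv_def using conv_integrable[OF f c z] by (simp add: scaleR_diff_right)
    also have "\<dots> \<le> (\<integral>y. norm (f y *\<^sub>R (K (x' - y) - K (x0 - y))) \<partial>lborel)" by (rule integral_norm_bound)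
    also have "\<dots> \<le> (\<integral>y. \<bar>f y\<bar> * (e / (A + 1)) \<partial>lborel)"
    proof (rule integral_mono)
      show "integrable lborel (\<lambda>y. norm (f y *\<^sub>R (K (x' - y) - K (x0 - y))))"
        using conv_integrable[OF f c z] by (simp add: scaleR_diff_right del: norm_scaleR)
      show "norm (f y *\<^sub>R (K (x' - y) - K (x0 - y))) \<le> \<bar>f y\<bar> * (e / (A + 1))" for y
        unfolding norm_scaleR using d(2)[of "x' - y" "x0 - y"] that
        by (intro mult_left_mono) (auto simp: dist_norm)
    qed (use f in simp)
    also have "\<dots> = e * (A / (A + 1))" by (simp add: A_def)
    also have "\<dots> < e" using \<open>0 < e\<close> A by (simp add: field_simps)
    finally show ?thesis by (simp add: dist_norm)
  qed
  then show "\<exists>d>0. \<forall>x'\<in>UNIV. dist x' x0 < d \<longrightarrow> dist (conv f K x') (conv f K x0) < e"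
    using d(1) by blast
qed

text \<open>Uniform continuity of the directional derivatives makes the linearisation error of
  \<open>K\<close> small relative to the increment, uniformly in the base point. Integrating this
  error against |f| bounds the linearisation error of the convolution.\<close>

lemma conv_has_derivative:
  fixes K :: "'a::euclidean_space \<Rightarrow> 'b::{banach, second_countable_topology}"
  assumes f: "integrable lborel f" and K: "\<And>x. (K has_derivative K' x) (at x)"
    and c: "\<And>h. continuous_on UNIV (\<lambda>x. K' x h)" and z: "\<And>x. norm x > R \<Longrightarrow> K x = 0"
  shows "(conv f K has_derivative (\<lambda>h. conv f (\<lambda>x. K' x h) x)) (at x)"
  unfolding has_derivative_at_alt
proof (intro conjI allI impI)
  have z': "K' x h = 0" if "norm x > R" for x h using has_derivative_vanishing[OF K z that] by simp
  have cK: "continuous_on UNIV K" using K by (rule has_derivative_continuous_on)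
  note lin = has_derivative_linear[OF K]
  note i = conv_integrable[OF f cK z] and i' = conv_integrable[OF f c z']
  have L: "linear (\<lambda>h. conv f (\<lambda>x. K' x h) x)"
  proof
    show "conv f (\<lambda>x. K' x (a + b)) x = conv f (\<lambda>x. K' x a) x + conv f (\<lambda>x. K' x b) x" for a b
      unfolding conv_def using i' by (simp add: linear_add[OF lin] scaleR_add_right)
    show "conv f (\<lambda>x. K' x (r *\<^sub>R a)) x = r *\<^sub>R conv f (\<lambda>x. K' x a) x" for r a
    proof -
      have "(\<lambda>y. f y *\<^sub>R r *\<^sub>R K' (x - y) a) = (\<lambda>y. r *\<^sub>R f y *\<^sub>R K' (x - y) a)"
        by (simp add: mult.commute)
      then show ?thesis unfolding conv_def by (simp only: linear_scale[OF lin] integral_scaleR_right i')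
    qed
  qed
  then show "bounded_linear (\<lambda>h. conv f (\<lambda>x. K' x h) x)" by (simp add: linear_conv_bounded_linear)
  fix e :: real assume "e > 0"
  define A where "A = (\<integral>y. \<bar>f y\<bar> \<partial>lborel)"
  have A: "A \<ge> 0" unfolding A_def by simp
  define \<epsilon> where "\<epsilon> = e / (A + 1)"
  have eps: "\<epsilon> > 0" using \<open>0 < e\<close> A by (simp add: \<epsilon>_def)
  \<comment> \<open>\<open>K'\<close> is continuous only direction by direction; the operator norm
    is estimated by a sum over \<open>Basis\<close>, so each basis direction receives an equal share
    of \<epsilon>.\<close>
  define \<eta> where "\<eta> = \<epsilon> / real DIM('a)"
  have eta: "\<eta> > 0" using eps by (simp add: \<eta>_def)
  have "\<exists>d>0. \<forall>b\<in>Basis. \<forall>x y. norm (x - y) < d \<longrightarrow> norm (K' x b - K' y b) < \<eta>"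
  proof -
    have "\<exists>d>0. \<forall>x y. norm (x - y) < d \<longrightarrow> norm (K' x b - K' y b) < \<eta>" for b
      using cts_vanishing_uniform[OF c z' eta] by metis
    then obtain d where d: "\<And>b. d b > 0" "\<And>b x y. norm (x - y) < d b \<Longrightarrow> norm (K' x b - K' y b) < \<eta>"
      by metis
    show ?thesis
      by (rule exI[of _ "Min (d ` Basis)"]) (auto simp: d)
  qed
  then obtain d where d: "d > 0" "\<And>b x y. b \<in> Basis \<Longrightarrow> norm (x - y) < d \<Longrightarrow> norm (K' x b - K' y b) < \<eta>"
    by blast
  have K'u: "onorm (\<lambda>h. K' x h - K' y h) \<le> \<epsilon>" if "norm (x - y) < d" for x y
  proof (rule onorm_le)
    fix h :: 'a
    define L where "L = (\<lambda>h. K' x h - K' y h)"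
    have l: "linear L" unfolding L_def by (intro linear_compose_sub lin)
    have "L h = L (\<Sum>b\<in>Basis. (h \<bullet> b) *\<^sub>R b)" by (simp add: euclidean_representation)
    also have "\<dots> = (\<Sum>b\<in>Basis. (h \<bullet> b) *\<^sub>R L b)" by (simp add: linear_sum[OF l] linear_scale[OF l])
    also have "norm \<dots> \<le> (\<Sum>b\<in>(Basis::'a set). norm h * \<eta>)"
      using less_imp_le[OF d(2)[OF _ that]] unfolding L_def
      by (intro sum_norm_le) (auto intro!: mult_mono Basis_le_norm)
    also have "\<dots> = \<epsilon> * norm h" by (simp add: \<eta>_def)
    finally show "norm (K' x h - K' y h) \<le> \<epsilon> * norm h" by (simp add: L_def)
  qed
  have rem: "norm (K w - K v - K' v (w - v)) \<le> norm (w - v) * \<epsilon>" if "norm (w - v) < d" for v w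
  proof (rule differentiable_bound_linearization[of v w "ball v d" K K' v \<epsilon>])
    show "v + t *\<^sub>R (w - v) \<in> ball v d" if "t \<in> {0..1}" for t
      using that \<open>norm (w - v) < d\<close> mult_right_mono[of t 1 "norm (w - v)"] by (auto simp: dist_norm)
    show "onorm (K' x - K' v) \<le> \<epsilon>" if "x \<in> ball v d" for x
      using that K'u[of x v] by (simp add: dist_norm norm_minus_commute fun_diff_def)
  qed (use d(1) K in \<open>auto intro: has_derivative_at_withinI\<close>)
  have "norm (conv f K y - conv f K x - conv f (\<lambda>z. K' z (y - x)) x) \<le> e * norm (y - x)"
    if y: "norm (y - x) < d" for y
  proof -
    let ?r = "\<lambda>z. K (y - z) - K (x - z) - K' (x - z) (y - x)"
    have ir: "integrable lborel (\<lambda>z. f z *\<^sub>R ?r z)"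
      unfolding scaleR_diff_right by (intro Bochner_Integration.integrable_diff i i')
    have "norm (conv f K y - conv f K x - conv f (\<lambda>z. K' z (y - x)) x) = norm (\<integral>z. f z *\<^sub>R ?r z \<partial>lborel)"
      unfolding conv_def using i i' by (simp add: scaleR_diff_right)
    also have "\<dots> \<le> (\<integral>z. norm (f z *\<^sub>R ?r z) \<partial>lborel)" by (rule integral_norm_bound)
    also have "\<dots> \<le> (\<integral>z. \<bar>f z\<bar> * (norm (y - x) * \<epsilon>) \<partial>lborel)"
    proof (rule integral_mono)
      show "norm (f z *\<^sub>R ?r z) \<le> \<bar>f z\<bar> * (norm (y - x) * \<epsilon>)" for z
        using rem[of "y - z" "x - z"] y by (auto intro!: mult_left_mono)
    qed (use f integrable_norm[OF ir] in \<open>simp_all del: norm_scaleR\<close>)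
    also have "\<dots> = (A / (A + 1) * e) * norm (y - x)" by (simp add: A_def \<epsilon>_def)
    also have "\<dots> \<le> e * norm (y - x)"
      using \<open>0 < e\<close> A by (intro mult_right_mono) (auto simp: field_simps)
    finally show ?thesis .
  qed
  then show "\<exists>d>0. \<forall>y. norm (y - x) < d \<longrightarrow>
      norm (conv f K y - conv f K x - conv f (\<lambda>z. K' z (y - x)) x) \<le> e * norm (y - x)"
    using d(1) by blast
qed

section \<open>A mollifier of class C^2 built from powers of a positive part\<close>

lemma DERIV_max0_power:
  assumes "n \<ge> 1"
  shows "((\<lambda>s::real. max 0 s ^ Suc n) has_real_derivative real (Suc n) * max 0 s ^ n) (at s)"
proof -
  consider "s > 0" | "s < 0" | "s = 0" by linarith
  then show ?thesis
  proof cases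
    case 1
    have "((\<lambda>s::real. s ^ Suc n) has_real_derivative real (Suc n) * max 0 s ^ n) (at s)"
      using DERIV_pow[of "Suc n" s] 1 by (simp add: max_def)
    then show ?thesis
      by (rule has_field_derivative_transform_within_open[of _ _ _ "{0<..}"]) (use 1 in auto)
  next
    case 2
    have "((\<lambda>s::real. 0) has_real_derivative real (Suc n) * max 0 s ^ n) (at s)"
      using 2 assms by (simp add: max_def zero_power)
    then show ?thesis
      by (rule has_field_derivative_transform_within_open[of _ _ _ "{..<0}"]) (use 2 in auto)
  next
    case 3
    \<comment> \<open>At the kink the difference quotient is at most |h|^n, and
      \<open>n \<ge> 1\<close> sends this to 0.\<close>
    have "((\<lambda>h::real. max 0 h ^ Suc n / h) \<longlongrightarrow> 0) (at 0)"
    proof (rule Lim_null_comparison)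
      show "eventually (\<lambda>h::real. norm (max 0 h ^ Suc n / h) \<le> \<bar>h\<bar> ^ n) (at 0)"
      proof (intro always_eventually allI)
        show "norm (max 0 h ^ Suc n / h) \<le> \<bar>h\<bar> ^ n" for h :: real
          by (cases "h > 0") auto
      qed
      show "((\<lambda>h::real. \<bar>h\<bar> ^ n) \<longlongrightarrow> 0) (at 0)"
        using assms by (auto intro!: tendsto_eq_intros)
    qed
    then show ?thesis using 3 assms by (simp add: DERIV_def zero_power)
  qed
qed

text \<open>The cube of the positive part of r^2 - |x|^2 is C^2 and vanishes outside the ball of
  radius r; division by its integral normalises it. Two derivatives are provided because the lower
  bound for \<open>TV\<close> by the gradient integral differentiates the gradient once
  more.\<close>

lemma mollifier_exists:
  assumes r: "r > 0"
  obtains K :: "'a::euclidean_space \<Rightarrow> real" and G H where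
    "\<And>x. (K has_derivative (\<lambda>h. G x \<bullet> h)) (at x)" "\<And>x. (G has_derivative H x) (at x)"
    "\<And>h. continuous_on UNIV (\<lambda>x. H x h)" "\<And>x. norm x > r \<Longrightarrow> K x = 0" "\<And>x. K x \<ge> 0"
    "(\<integral>x. K x \<partial>lborel) = 1"
proof -
  define q where "q x = r\<^sup>2 - x \<bullet> x" for x :: 'a
  define k where "k x = max 0 (q x) ^ 3" for x :: 'a
  have dq: "(q has_derivative (\<lambda>h. - 2 * (x \<bullet> h))) (at x)" for x
    unfolding q_def[abs_def] by (auto intro!: derivative_eq_intros simp: inner_commute)
  have d3: "(k has_derivative (\<lambda>h. (- 6 * max 0 (q x) ^ 2) * (x \<bullet> h))) (at x)" for x
    unfolding k_def[abs_def] using has_derivative_compose[OF dq DERIV_max0_power[of 2, simplified, unfolded has_field_derivative_def]]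
    by (simp add: mult.assoc mult.left_commute numeral_eq_Suc)
  have d2: "((\<lambda>x. max 0 (q x) ^ 2) has_derivative (\<lambda>h. (- 4 * max 0 (q x)) * (x \<bullet> h))) (at x)" for x
    using has_derivative_compose[OF dq DERIV_max0_power[of 1, simplified, unfolded has_field_derivative_def]]
    by (simp add: mult.assoc mult.left_commute numeral_eq_Suc)
  have cq: "continuous_on UNIV q" unfolding q_def by (intro continuous_intros)
  have ck: "continuous_on UNIV k" unfolding k_def by (intro continuous_intros cq)
  have zk: "k x = 0" if "norm x > r" for x
  proof -
    have "r\<^sup>2 \<le> (norm x)\<^sup>2" using that r by (intro power_mono) auto
    then show ?thesis by (simp add: k_def q_def power2_norm_eq_inner)
  qed
  have ik: "integrable lborel k" by (rule cts_vanishing_integrable[OF ck zk])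
  define I where "I = (\<integral>x. k x \<partial>lborel)"
  \<comment> \<open>A vanishing integral would make \<open>k\<close> zero almost everywhere, and
    hence the open ball, on which \<open>k\<close> is positive, a null set.\<close>
  have "I \<noteq> 0"
  proof
    assume "I = 0"
    then have "AE x in lborel. k x = 0"
      unfolding I_def using integral_nonneg_eq_0_iff_AE[OF ik] by (simp add: k_def)
    then have "AE x in lborel. x \<notin> ball (0::'a) r"
    proof eventually_elim
      case (elim x)
      then have "\<not> 0 < q x" by (auto simp: k_def max_def split: if_splits)
      then have "r\<^sup>2 \<le> (norm x)\<^sup>2" by (simp add: q_def power2_norm_eq_inner)
      then show ?case using power2_le_imp_le[of r "norm x"] by simp
    qed
    then have "ball (0::'a) r \<in> null_sets lborel"
      by (subst (asm) AE_iff_null_sets[symmetric]) auto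
    then have "negligible (ball (0::'a) r)"
      using negligible_iff_null_sets null_sets_completionI by blast
    then show False using open_not_negligible[of "ball (0::'a) r"] r by simp
  qed
  moreover have "I \<ge> 0" unfolding I_def by (intro integral_nonneg_AE) (simp add: k_def)
  ultimately have I: "I > 0" by simp
  define K where "K x = k x / I" for x
  \<comment> \<open>The factor -6 is 3 times the -2 in the derivative of \<open>q\<close>; the 24 in
    \<open>H\<close> is -6 times the -4 of \<open>d2\<close>.\<close>
  define G where "G x = (- 6 / I * max 0 (q x) ^ 2) *\<^sub>R x" for x
  define H where "H x h = (24 / I * max 0 (q x) * (x \<bullet> h)) *\<^sub>R x + (- 6 / I * max 0 (q x) ^ 2) *\<^sub>R h" for x h :: 'a
  show ?thesis
  proof (rule that)
    show "(K has_derivative (\<lambda>h. G x \<bullet> h)) (at x)" for x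
      unfolding K_def[abs_def] G_def using I by (auto intro!: derivative_eq_intros d3 simp: field_simps)
    show "(G has_derivative H x) (at x)" for x
      unfolding G_def[abs_def] H_def
      by (rule has_derivative_eq_rhs[OF has_derivative_scaleR[OF has_derivative_mult_right[OF d2] has_derivative_ident]])
        (simp add: fun_eq_iff mult.assoc)
    show "continuous_on UNIV (\<lambda>x. H x h)" for h
      unfolding H_def by (intro continuous_intros cq)
    show "norm x > r \<Longrightarrow> K x = 0" for x using zk by (simp add: K_def)
    show "K x \<ge> 0" for x using I by (simp add: K_def k_def)
    show "(\<integral>x. K x \<partial>lborel) = 1" using I by (simp add: K_def I_def)
  qed
qed

lemma conv_commute:
  fixes f K :: "'a::euclidean_space \<Rightarrow> real"
  assumes f: "integrable lborel f" and c: "continuous_on UNIV K" and z: "\<And>x. norm x > R \<Longrightarrow> K x = 0"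
  shows "conv f K x = (\<integral>y. K y * f (x - y) \<partial>lborel)" and "integrable lborel (\<lambda>y. K y * f (x - y))"
proof -
  note [measurable] = borel_measurable_integrable[OF f] borel_measurable_continuous_onI[OF c]
  have m: "(\<lambda>y. f y * K (x - y)) \<in> borel_measurable borel" by measurable
  show "conv f K x = (\<integral>y. K y * f (x - y) \<partial>lborel)"
    unfolding conv_def using integral_lborel_reflect[OF m, of x] by (simp add: mult.commute)
  show "integrable lborel (\<lambda>y. K y * f (x - y))"
    using conv_integrable[OF f c z, of R x] integrable_lborel_reflect[OF m, of x] by (simp add: mult.commute)
qed

lemma conv_vanishing:
  assumes zf: "\<And>x. norm x > S \<Longrightarrow> f x = 0" and z: "\<And>x. norm x > R \<Longrightarrow> K x = 0" and x: "norm x > R + S"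
  shows "conv f K x = 0"
proof -
  have "f y *\<^sub>R K (x - y) = 0" for y
  proof (cases "norm y > S")
    case False
    then have "norm (x - y) > R" using norm_triangle_sub[of x y] x by simp
    then show ?thesis using z by simp
  qed (simp add: zf)
  then show ?thesis unfolding conv_def by (simp only: Bochner_Integration.integral_zero)
qed

text \<open>By Fubini and a translation, the pairing of the convolution with \<phi> is the
  \<open>K\<close>-weighted average of the pairings of \<open>f\<close> with translates of \<phi>.
  The translates are again test fields, so each of these pairings is at most
  \<open>TV f\<close>.\<close>

lemma TV_conv_le:
  assumes f: "integrable lborel f" and c: "continuous_on UNIV K" and z: "\<And>x. norm x > R \<Longrightarrow> K x = 0"
    and K0: "\<And>x. K x \<ge> 0" and K1: "(\<integral>x. K x \<partial>lborel) = 1"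
  shows "TV (conv f K) \<le> TV f"
proof (cases "TV f = \<infinity>")
  case False
  note [measurable] = borel_measurable_integrable[OF f] borel_measurable_continuous_onI[OF c]
  define T where "T = enn2real (TV f)"
  have T: "TV f = ennreal T" "T \<ge> 0" using False by (simp_all add: T_def less_top)
  have iK: "integrable lborel K" by (rule cts_vanishing_integrable[OF c z])
  have cc: "continuous_on UNIV (conv f K)" by (rule conv_continuous[OF f c z])
  show ?thesis
  proof (rule TV_least)
    fix \<phi> assume \<phi>: "\<phi> \<in> test_fields"
    obtain B where B: "B > 0" "\<And>x. \<bar>divergence \<phi> x\<bar> \<le> B" by (rule divergence_props[OF \<phi>]) blast
    note [measurable] = divergence_measurable[OF \<phi>]
    define F where "F y x = K y * (f (x - y) * divergence \<phi> x)" for y x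
    have Fm[measurable]: "case_prod F \<in> borel_measurable (lborel \<Otimes>\<^sub>M lborel)"
      unfolding F_def[abs_def] by measurable
    have tr: "integrable lborel (\<lambda>x. f (x - y))" "(\<integral>x. \<bar>f (x - y)\<bar> \<partial>lborel) = (\<integral>x. \<bar>f x\<bar> \<partial>lborel)" for y
      using integrable_lborel_translate[of f "- y"] integral_lborel_translate[of "\<lambda>x. \<bar>f x\<bar>" "- y"] f by simp_all
    have iy: "integrable lborel (\<lambda>x. f (x - y) * divergence \<phi> x)" for y
      using integrable_divergence_lborel[OF _ \<phi> tr(1)[of y]] by measurable
    have iF: "integrable (lborel \<Otimes>\<^sub>M lborel) (case_prod F)"
    proof (rule lborel_pair.Fubini_integrable)
      have "(\<integral>x. \<bar>f (x - y) * divergence \<phi> x\<bar> \<partial>lborel) \<le> (\<integral>x. B * \<bar>f (x - y)\<bar> \<partial>lborel)" for y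
      proof (rule integral_mono)
        show "\<bar>f (x - y) * divergence \<phi> x\<bar> \<le> B * \<bar>f (x - y)\<bar>" for x
          using mult_left_mono[OF B(2)[of x] abs_ge_zero[of "f (x - y)"]] by (simp add: abs_mult mult.commute)
      qed (use iy tr in auto)
      then have b: "(\<integral>x. \<bar>f (x - y) * divergence \<phi> x\<bar> \<partial>lborel) \<le> B * (\<integral>x. \<bar>f x\<bar> \<partial>lborel)" for y
        using tr by simp
      show "integrable lborel (\<lambda>x. \<integral>y. norm (case (x, y) of (x, y) \<Rightarrow> F x y) \<partial>lborel)"
      proof (rule Bochner_Integration.integrable_bound)
        show "integrable lborel (\<lambda>y. K y * (B * (\<integral>x. \<bar>f x\<bar> \<partial>lborel)))" using iK by simp
        have "norm (\<integral>x. norm (F y x) \<partial>lborel) \<le> norm (K y * (B * (\<integral>x. \<bar>f x\<bar> \<partial>lborel)))" for y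
        proof -
          have "(\<integral>x. norm (F y x) \<partial>lborel) = K y * (\<integral>x. \<bar>f (x - y) * divergence \<phi> x\<bar> \<partial>lborel)"
            unfolding F_def using K0[of y] by (simp add: abs_mult)
          also have "\<dots> \<le> K y * (B * (\<integral>x. \<bar>f x\<bar> \<partial>lborel))"
            by (rule mult_left_mono[OF b K0])
          finally show ?thesis using B(1) K0[of y] by simp
        qed
        then show "AE y in lborel. norm (\<integral>x. norm (case (y, x) of (x, y) \<Rightarrow> F x y) \<partial>lborel)
            \<le> norm (K y * (B * (\<integral>x. \<bar>f x\<bar> \<partial>lborel)))" by simp
      qed measurable
      show "AE y in lborel. integrable lborel (\<lambda>x. case (y, x) of (x, y) \<Rightarrow> F x y)"
        using iy by (simp add: F_def)
    qed measurable
    have "(\<integral>x. conv f K x * divergence \<phi> x \<partial>lebesgue) = (\<integral>x. conv f K x * divergence \<phi> x \<partial>lborel)"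
      by (rule integral_divergence_lborel[OF borel_measurable_continuous_onI[OF cc] \<phi>])
    also have "\<dots> = (\<integral>x. (\<integral>y. F y x \<partial>lborel) \<partial>lborel)"
    proof -
      have "conv f K x * divergence \<phi> x = (\<integral>y. F y x \<partial>lborel)" for x
        using conv_commute(1)[OF f c z, of R x] by (simp add: F_def mult.assoc[symmetric])
      then show ?thesis by simp
    qed
    also have "\<dots> = (\<integral>y. (\<integral>x. F y x \<partial>lborel) \<partial>lborel)"
      by (rule lborel_pair.Fubini_integral[OF iF])
    also have "\<dots> \<le> (\<integral>y. K y * T \<partial>lborel)"
    proof (rule integral_mono)
      show "integrable lborel (\<lambda>y. \<integral>x. F y x \<partial>lborel)"
        using lborel_pair.integrable_fst'[OF iF] by simp
      show "integrable lborel (\<lambda>y. K y * T)" using iK by simp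
      show "(\<integral>x. F y x \<partial>lborel) \<le> K y * T" for y
      proof -
        have "(\<integral>x. f (x - y) * divergence \<phi> x \<partial>lborel) = (\<integral>x. f (y + x - y) * divergence \<phi> (y + x) \<partial>lborel)"
          by (rule integral_lborel_translate[symmetric]) measurable
        also have "\<dots> = (\<integral>x. f x * divergence (\<lambda>x. \<phi> (y + x)) x \<partial>lebesgue)"
          using integral_divergence_lborel[OF _ test_fields_translate[OF \<phi>], of f y]
          by (simp add: divergence_translate[OF \<phi>])
        also have "ennreal \<dots> \<le> ennreal T"
          unfolding T(1)[symmetric] by (rule TV_upper[OF test_fields_translate[OF \<phi>]])
        finally have "(\<integral>x. f (x - y) * divergence \<phi> x \<partial>lborel) \<le> T" using T(2) by (simp add: ennreal_le_iff)
        then show ?thesis unfolding F_def using mult_left_mono[OF _ K0] by simp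
      qed
    qed
    also have "\<dots> = T" using K1 by simp
    finally show "ennreal (\<integral>x. conv f K x * divergence \<phi> x \<partial>lebesgue) \<le> TV f"
      unfolding T by (rule ennreal_leI)
  qed
qed simp

text \<open>The difference at x is the \<open>K\<close>-average of f(x - y) - f(x), where only
  \<open>norm y \<le> r\<close> contributes. Working with nonnegative integrals allows the order of
  integration to be exchanged at once and yields integrability of the difference together with the
  bound.\<close>

lemma conv_L1_dist:
  fixes f K :: "'a::euclidean_space \<Rightarrow> real"
  assumes f: "integrable lborel f" and c: "continuous_on UNIV K" and z: "\<And>x. norm x > r \<Longrightarrow> K x = 0"
    and K0: "\<And>x. K x \<ge> 0" and K1: "(\<integral>x. K x \<partial>lborel) = 1"
    and e: "\<And>y. norm y \<le> r \<Longrightarrow> (\<integral>x. \<bar>f (x - y) - f x\<bar> \<partial>lborel) \<le> e" and e0: "e \<ge> 0"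
  shows "integrable lborel (\<lambda>x. conv f K x - f x)" and "(\<integral>x. \<bar>conv f K x - f x\<bar> \<partial>lborel) \<le> e"
proof -
  have cc: "continuous_on UNIV (conv f K)" by (rule conv_continuous[OF f c z])
  note [measurable] = borel_measurable_integrable[OF f] borel_measurable_continuous_onI[OF c]
    borel_measurable_continuous_onI[OF cc]
  have iK: "integrable lborel K" by (rule cts_vanishing_integrable[OF c z])
  have tr: "integrable lborel (\<lambda>x. f (x - y))" for y
    using integrable_lborel_translate[of f "- y"] f by simp
  have "(\<integral>\<^sup>+x. ennreal \<bar>conv f K x - f x\<bar> \<partial>lborel)
      \<le> (\<integral>\<^sup>+x. (\<integral>\<^sup>+y. ennreal (K y * \<bar>f (x - y) - f x\<bar>) \<partial>lborel) \<partial>lborel)"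
  proof (rule nn_integral_mono)
    fix x
    have "conv f K x - f x = (\<integral>y. K y * f (x - y) \<partial>lborel) - (\<integral>y. K y * f x \<partial>lborel)"
      using conv_commute(1)[OF f c z] K1 by simp
    also have "\<dots> = (\<integral>y. K y * (f (x - y) - f x) \<partial>lborel)"
      using conv_commute(2)[OF f c z] iK by (simp add: right_diff_distrib)
    finally have "ennreal \<bar>conv f K x - f x\<bar> = ennreal (norm (\<integral>y. K y * (f (x - y) - f x) \<partial>lborel))"
      by simp
    also have "\<dots> \<le> (\<integral>\<^sup>+y. ennreal (norm (K y * (f (x - y) - f x))) \<partial>lborel)"
      using conv_commute(2)[OF f c z] iK by (intro integral_norm_bound_ennreal) (simp add: right_diff_distrib)
    finally show "ennreal \<bar>conv f K x - f x\<bar> \<le> (\<integral>\<^sup>+y. ennreal (K y * \<bar>f (x - y) - f x\<bar>) \<partial>lborel)"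
      using K0 by (simp add: abs_mult)
  qed
  also have "\<dots> = (\<integral>\<^sup>+y. (\<integral>\<^sup>+x. ennreal (K y * \<bar>f (x - y) - f x\<bar>) \<partial>lborel) \<partial>lborel)"
    by (rule lborel_pair.Fubini') measurable
  also have "\<dots> \<le> (\<integral>\<^sup>+y. ennreal (K y * e) \<partial>lborel)"
  proof (rule nn_integral_mono)
    fix y
    show "(\<integral>\<^sup>+x. ennreal (K y * \<bar>f (x - y) - f x\<bar>) \<partial>lborel) \<le> ennreal (K y * e)"
    proof (cases "norm y > r")
      case False
      have "(\<integral>\<^sup>+x. ennreal (K y * \<bar>f (x - y) - f x\<bar>) \<partial>lborel) = ennreal (\<integral>x. K y * \<bar>f (x - y) - f x\<bar> \<partial>lborel)"
        using tr f K0 by (intro nn_integral_eq_integral) auto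
      also have "\<dots> \<le> ennreal (K y * e)"
        using mult_left_mono[OF e[of y] K0[of y]] False by (intro ennreal_leI) simp
      finally show ?thesis .
    qed (simp add: z)
  qed
  also have "\<dots> = ennreal (\<integral>y. K y * e \<partial>lborel)"
    using iK K0 e0 by (intro nn_integral_eq_integral) auto
  also have "\<dots> = ennreal e" using K1 by simp
  finally have *: "(\<integral>\<^sup>+x. ennreal \<bar>conv f K x - f x\<bar> \<partial>lborel) \<le> ennreal e" .
  then show i: "integrable lborel (\<lambda>x. conv f K x - f x)"
    by (intro integrableI_bounded) (auto intro: le_less_trans)
  show "(\<integral>x. \<bar>conv f K x - f x\<bar> \<partial>lborel) \<le> e"
    using * e0 i by (subst (asm) nn_integral_eq_integral) auto
qed

section \<open>Truncation\<close>

text \<open>The divergence of a test field is bounded and integrable, so its product with an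
  integrable or with a constant majorant is integrable. Truncations of \<open>w\<close> use the
  first kind of majorant, indicator functions the second.\<close>

lemma pairing_tendsto_dominated:
  assumes \<phi>: "\<phi> \<in> test_fields"
    and [measurable]: "\<And>n. V n \<in> borel_measurable lebesgue" "v \<in> borel_measurable lebesgue"
    and lim: "AE x in lebesgue. (\<lambda>n. V n x) \<longlonglongrightarrow> v x"
    and b: "\<And>n. AE x in lebesgue. \<bar>V n x\<bar> \<le> h x"
    and h: "integrable lebesgue h \<or> h = (\<lambda>x. C)"
  shows "(\<lambda>n. \<integral>x. V n x * divergence \<phi> x \<partial>lebesgue) \<longlonglongrightarrow> (\<integral>x. v x * divergence \<phi> x \<partial>lebesgue)"
proof (rule integral_dominated_convergence)
  note [measurable] = divergence_measurable_lebesgue[OF \<phi>]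
  have "integrable lebesgue (divergence \<phi>)"
    using divergence_integrable[OF \<phi>] divergence_measurable[OF \<phi>] by (simp add: integrable_completion)
  then have "integrable lebesgue (\<lambda>x. h x * divergence \<phi> x)"
    using h integrable_mult_divergence[OF _ \<phi>] by auto
  then show "integrable lebesgue (\<lambda>x. \<bar>h x * divergence \<phi> x\<bar>)" by simp
  show "AE x in lebesgue. (\<lambda>n. V n x * divergence \<phi> x) \<longlonglongrightarrow> v x * divergence \<phi> x"
    using lim by eventually_elim (intro tendsto_intros)
  show "AE x in lebesgue. norm (V n x * divergence \<phi> x) \<le> \<bar>h x * divergence \<phi> x\<bar>" for n
    using b[of n] by eventually_elim (auto simp: abs_mult intro!: mult_right_mono)
  show "(\<lambda>x. V n x * divergence \<phi> x) \<in> borel_measurable lebesgue" for n by measurable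
  show "(\<lambda>x. v x * divergence \<phi> x) \<in> borel_measurable lebesgue" by measurable
qed

lemma pairing_tendsto_L1:
  assumes \<phi>: "\<phi> \<in> test_fields"
    and V: "\<And>n. integrable lebesgue (V n)" and v: "integrable lebesgue v"
    and lim: "(\<lambda>n. \<integral>x. \<bar>V n x - v x\<bar> \<partial>lebesgue) \<longlonglongrightarrow> 0"
  shows "(\<lambda>n. \<integral>x. V n x * divergence \<phi> x \<partial>lebesgue) \<longlonglongrightarrow> (\<integral>x. v x * divergence \<phi> x \<partial>lebesgue)"
proof -
  obtain B where B: "B > 0" "\<And>x. \<bar>divergence \<phi> x\<bar> \<le> B" by (rule divergence_props[OF \<phi>]) blast
  have i: "integrable lebesgue (\<lambda>x. \<bar>V n x - v x\<bar>)" for n using V v by simp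
  have i2: "integrable lebesgue (\<lambda>x. (V n x - v x) * divergence \<phi> x)" for n
    using integrable_mult_divergence[OF _ \<phi>, of "\<lambda>x. V n x - v x"] V v by simp
  have "\<bar>(\<integral>x. V n x * divergence \<phi> x \<partial>lebesgue) - (\<integral>x. v x * divergence \<phi> x \<partial>lebesgue)\<bar>
      \<le> B * (\<integral>x. \<bar>V n x - v x\<bar> \<partial>lebesgue)" for n
  proof -
    have "\<bar>(\<integral>x. V n x * divergence \<phi> x \<partial>lebesgue) - (\<integral>x. v x * divergence \<phi> x \<partial>lebesgue)\<bar>
        = norm (\<integral>x. (V n x - v x) * divergence \<phi> x \<partial>lebesgue)"
      using V v \<phi> by (simp add: left_diff_distrib integrable_mult_divergence)
    also have "\<dots> \<le> (\<integral>x. norm ((V n x - v x) * divergence \<phi> x) \<partial>lebesgue)" by (rule integral_norm_bound)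
    also have "\<dots> \<le> (\<integral>x. B * \<bar>V n x - v x\<bar> \<partial>lebesgue)"
    proof (rule integral_mono)
      show "norm ((V n x - v x) * divergence \<phi> x) \<le> B * \<bar>V n x - v x\<bar>" for x
        using mult_left_mono[OF B(2)[of x] abs_ge_zero[of "V n x - v x"]] by (simp add: abs_mult mult.commute)
    qed (use i2[of n] i[of n] in \<open>auto intro: integrable_norm\<close>)
    finally show ?thesis by simp
  qed
  then have "(\<lambda>n. (\<integral>x. V n x * divergence \<phi> x \<partial>lebesgue) - (\<integral>x. v x * divergence \<phi> x \<partial>lebesgue)) \<longlonglongrightarrow> 0"
    by (intro Lim_null_comparison[OF _ tendsto_mult_right_zero[OF lim, of B]] always_eventually) simp
  then show ?thesis by (rule LIM_zero_cancel)
qed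

text \<open>The mollifier radius lies below the threshold at which translations move
  \<open>w\<close> by at most \<open>e\<close> in L^1. The existential form lets a whole sequence of
  approximations be chosen afterwards.\<close>

lemma smooth_L1_approximation:
  fixes w :: "real^2 \<Rightarrow> real"
  assumes w: "integrable lborel w" and z: "\<And>x. norm x > R \<Longrightarrow> w x = 0" and e: "e > 0"
  shows "\<exists>g G H S. (\<forall>x. (g has_derivative (\<lambda>h. G x \<bullet> h)) (at x)) \<and> (\<forall>x. (G has_derivative H x) (at x)) \<and>
    (\<forall>h. continuous_on UNIV (\<lambda>x. H x h)) \<and> (\<forall>x. norm x > S \<longrightarrow> g x = 0) \<and>
    TV g \<le> TV w \<and> (\<integral>x. \<bar>g x - w x\<bar> \<partial>lborel) \<le> e"
proof -
  obtain d where d: "d > 0" "\<And>y. norm y < d \<Longrightarrow> (\<integral>x. \<bar>w (x - y) - w x\<bar> \<partial>lborel) \<le> e"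
    using translation_continuous_L1[OF w e] by blast
  define r where "r = d / 2"
  have r: "r > 0" "r < d" using d(1) by (simp_all add: r_def)
  obtain K G H where K: "\<And>x. (K has_derivative (\<lambda>h. G x \<bullet> h)) (at x)"
    and G: "\<And>x. (G has_derivative H x) (at x)" and H: "\<And>h. continuous_on UNIV (\<lambda>x::real^2. H x h)"
    and zK: "\<And>x. norm x > r \<Longrightarrow> K x = 0" and K0: "\<And>x. K x \<ge> 0" and K1: "(\<integral>x. K x \<partial>lborel) = 1"
    using mollifier_exists[OF r(1), where 'a="real^2"] by blast
  have zG: "G x = 0" if "norm x > r" for x
  proof -
    have "(\<lambda>h. G x \<bullet> h) = (\<lambda>h. 0)" by (rule has_derivative_vanishing[OF K zK that])
    then have "G x \<bullet> G x = 0" by metis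
    then show ?thesis by simp
  qed
  have cK: "continuous_on UNIV K" using K by (rule has_derivative_continuous_on)
  have cG: "continuous_on UNIV G" using G by (rule has_derivative_continuous_on)
  show ?thesis
  proof (intro exI conjI allI impI)
    have "conv w (\<lambda>x. G x \<bullet> h) x = conv w G x \<bullet> h" for x h
    proof -
      have i: "integrable lborel (\<lambda>y. w y *\<^sub>R G (x - y))" by (rule conv_integrable[OF w cG zG])
      show ?thesis unfolding conv_def using integral_inner_left[of h lborel "\<lambda>y. w y *\<^sub>R G (x - y)"] i by simp
    qed
    moreover have "(conv w K has_derivative (\<lambda>h. conv w (\<lambda>x. G x \<bullet> h) x)) (at x)" for x
      by (rule conv_has_derivative[OF w K _ zK]) (intro continuous_intros cG)
    ultimately show "(conv w K has_derivative (\<lambda>h. conv w G x \<bullet> h)) (at x)" for x by simp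
    show "(conv w G has_derivative (\<lambda>h. conv w (\<lambda>x. H x h) x)) (at x)" for x
      by (rule conv_has_derivative[OF w G H zG])
    have zH: "H x h = 0" if "norm x > r" for x h using has_derivative_vanishing[OF G zG that] by simp
    show "continuous_on UNIV (\<lambda>x. conv w (\<lambda>x. H x h) x)" for h
      using conv_continuous[OF w H zH] by simp
    show "conv w K x = 0" if "norm x > r + R" for x
      by (rule conv_vanishing[OF z zK that])
    show "TV (conv w K) \<le> TV w" by (rule TV_conv_le[OF w cK zK K0 K1])
    show "(\<integral>x. \<bar>conv w K x - w x\<bar> \<partial>lborel) \<le> e"
      by (rule conv_L1_dist(2)[OF w cK zK K0 K1 d(2)]) (use r e in auto)
  qed
qed

text \<open>The smooth inequality is applied to mollifications of \<open>w\<close>, whose total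
  variation is at most \<open>TV w\<close>. Both \<open>b\<close> and t - b(t) are 1-Lipschitz and
  vanish at 0, so the two pieces converge in L^1 and lower semicontinuity applies.\<close>

lemma TV_split_C1:
  fixes w :: "real^2 \<Rightarrow> real"
  assumes w: "integrable lborel w" and z: "\<And>x. norm x > R \<Longrightarrow> w x = 0"
    and b: "\<And>t. (b has_real_derivative b' t) (at t)" and cb': "continuous_on UNIV b'"
    and b': "\<And>t. 0 \<le> b' t" "\<And>t. b' t \<le> 1" and b0: "b 0 = 0"
  shows "TV (\<lambda>x. b (w x)) + TV (\<lambda>x. w x - b (w x)) \<le> TV w"
proof -
  have "\<forall>n. \<exists>g G H S. (\<forall>x. (g has_derivative (\<lambda>h. G x \<bullet> h)) (at x)) \<and> (\<forall>x. (G has_derivative H x) (at x)) \<and>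
    (\<forall>h. continuous_on UNIV (\<lambda>x. H x h)) \<and> (\<forall>x. norm x > S \<longrightarrow> g x = 0) \<and>
    TV g \<le> TV w \<and> (\<integral>x. \<bar>g x - w x\<bar> \<partial>lborel) \<le> 1 / real (Suc n)"
    by (intro allI smooth_L1_approximation[OF w z]) auto
  then obtain g G H S where P: "\<forall>n. (\<forall>x. (g n has_derivative (\<lambda>h. G n x \<bullet> h)) (at x)) \<and>
    (\<forall>x. (G n has_derivative H n x) (at x)) \<and>
    (\<forall>h. continuous_on UNIV (\<lambda>x. H n x h)) \<and> (\<forall>x. norm x > S n \<longrightarrow> g n x = 0) \<and>
    TV (g n) \<le> TV w \<and> (\<integral>x. \<bar>g n x - w x\<bar> \<partial>lborel) \<le> 1 / real (Suc n)"
    unfolding choice_iff by (elim exE)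
  have g: "(g n has_derivative (\<lambda>h. G n x \<bullet> h)) (at x)" and G: "(G n has_derivative H n x) (at x)"
    and H: "continuous_on UNIV (\<lambda>x. H n x h)" and zg: "norm x > S n \<Longrightarrow> g n x = 0" and TVg: "TV (g n) \<le> TV w"
    and d: "(\<integral>x. \<bar>g n x - w x\<bar> \<partial>lborel) \<le> 1 / real (Suc n)" for n x h
    using P by simp_all
  have zG: "G n x = 0" if "norm x > S n" for n x
  proof -
    have "(\<lambda>h. G n x \<bullet> h) = (\<lambda>h. 0)" by (rule has_derivative_vanishing[OF g zg that])
    then have "G n x \<bullet> G n x = 0" by metis
    then show ?thesis by simp
  qed
  have mvt: "0 \<le> b t - b s \<and> b t - b s \<le> t - s" if "s \<le> t" for s t
  proof (cases "s = t")
    case False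
    then have "s < t" using that by simp
    from MVT2[OF this b] obtain \<xi> where "b t - b s = (t - s) * b' \<xi>" by blast
    then show ?thesis using b'[of \<xi>] that by (simp add: mult_left_le)
  qed simp
  have bl: "\<bar>b t - b s\<bar> \<le> \<bar>t - s\<bar>" "\<bar>(t - b t) - (s - b s)\<bar> \<le> \<bar>t - s\<bar>" for s t
    using mvt[of s t] mvt[of t s] by linarith+
  have cb: "continuous_on UNIV b"
    using b by (intro continuous_at_imp_continuous_on) (auto intro: DERIV_isCont)
  note [measurable] = borel_measurable_integrable[OF w] borel_measurable_continuous_onI[OF cb]
  have cg: "continuous_on UNIV (g n)" for n using g by (rule has_derivative_continuous_on)
  have ig: "integrable lborel (g n)" for n by (rule cts_vanishing_integrable[OF cg zg])
  note [measurable] = borel_measurable_integrable[OF ig]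
  have conv: "(\<lambda>n. \<integral>x. k (g n x) * divergence \<phi> x \<partial>lebesgue) \<longlonglongrightarrow> (\<integral>x. k (w x) * divergence \<phi> x \<partial>lebesgue)"
    if km[measurable]: "k \<in> borel_measurable borel" and kl: "\<And>s t. \<bar>k t - k s\<bar> \<le> \<bar>t - s\<bar>"
      and k0: "k 0 = 0" and \<phi>: "\<phi> \<in> test_fields" for k :: "real \<Rightarrow> real" and \<phi>
  proof (rule pairing_tendsto_L1[OF \<phi>])
    have ki: "integrable lborel (\<lambda>x. k (v x))" if v: "integrable lborel v" for v :: "real^2 \<Rightarrow> real"
    proof (rule Bochner_Integration.integrable_bound[OF v])
      show "(\<lambda>x. k (v x)) \<in> borel_measurable lborel" using borel_measurable_integrable[OF v] by measurable
      show "AE x in lborel. norm (k (v x)) \<le> norm (v x)" using kl[of _ 0] k0 by simp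
    qed
    show "integrable lebesgue (\<lambda>x. k (g n x))" for n using ki[OF ig] by (simp add: integrable_completion)
    show "integrable lebesgue (\<lambda>x. k (w x))" using ki[OF w] by (simp add: integrable_completion)
    show "(\<lambda>n. \<integral>x. \<bar>k (g n x) - k (w x)\<bar> \<partial>lebesgue) \<longlonglongrightarrow> 0"
    proof (rule Lim_null_comparison)
      have "(\<integral>x. \<bar>k (g n x) - k (w x)\<bar> \<partial>lborel) \<le> (\<integral>x. \<bar>g n x - w x\<bar> \<partial>lborel)" for n
        using ki[OF ig] ki[OF w] ig w kl by (intro integral_mono) auto
      then show "eventually (\<lambda>n. norm (\<integral>x. \<bar>k (g n x) - k (w x)\<bar> \<partial>lebesgue) \<le> 1 / real (Suc n)) sequentially"
        using d by (intro always_eventually) (auto simp: integral_completion intro: order_trans)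
      show "(\<lambda>n. 1 / real (Suc n)) \<longlonglongrightarrow> 0" by (rule LIMSEQ_Suc[OF lim_1_over_n])
    qed
  qed
  show ?thesis
  proof (rule TV_add_lsc)
    show "TV (\<lambda>x. b (g n x)) + TV (\<lambda>x. g n x - b (g n x)) \<le> TV w" for n
      by (rule order_trans[OF TV_split_smooth[OF g G H zG b cb' b'] TVg])
    show "(\<lambda>n. \<integral>x. b (g n x) * divergence \<phi> x \<partial>lebesgue) \<longlonglongrightarrow> (\<integral>x. b (w x) * divergence \<phi> x \<partial>lebesgue)"
      if "\<phi> \<in> test_fields" for \<phi>
      by (rule conv[OF _ bl(1) b0 that]) measurable
    show "(\<lambda>n. \<integral>x. (g n x - b (g n x)) * divergence \<phi> x \<partial>lebesgue) \<longlonglongrightarrow> (\<integral>x. (w x - b (w x)) * divergence \<phi> x \<partial>lebesgue)"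
      if "\<phi> \<in> test_fields" for \<phi>
      by (rule conv[OF _ bl(2) _ that]) (measurable, simp add: b0)
  qed
qed

text \<open>The positive part of t - c has a kink, so it is replaced by C^1 functions and recovered
  by dominated convergence. The second piece is the remainder, since min(t, c) = t - max(0, t - c);
  \<open>c \<ge> 0\<close> makes the approximations vanish at 0 and lets |w| dominate both
  pieces.\<close>

lemma TV_split:
  fixes w :: "real^2 \<Rightarrow> real"
  assumes w: "integrable lborel w" and z: "\<And>x. norm x > R \<Longrightarrow> w x = 0" and c: "c \<ge> 0"
  shows "TV (\<lambda>x. max 0 (w x - c)) + TV (\<lambda>x. min (w x) c) \<le> TV w"
proof -
  define \<delta> where "\<delta> n = 1 / real (Suc n)" for n
  have \<delta>: "\<delta> n > 0" for n by (simp add: \<delta>_def)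
  \<comment> \<open>\<open>b n\<close> is a \<open>C\<^sup>1\<close> approximation of \<open>\<lambda>t. max 0 (t - c)\<close> with slope between 0 and 1.\<close>
  define q where "q n t = sqrt (max 0 (t - c) ^ 2 + (\<delta> n)\<^sup>2)" for n t
  have qpos: "max 0 (t - c) ^ 2 + (\<delta> n)\<^sup>2 > 0" for n t using \<delta>[of n] by (intro add_nonneg_pos) auto
  define b where "b n t = q n t - \<delta> n" for n t
  define b' where "b' n t = max 0 (t - c) / q n t" for n t
  have q: "q n t > 0" "max 0 (t - c) \<le> q n t" "q n t \<le> max 0 (t - c) + \<delta> n" for n t
  proof -
    show "q n t > 0" unfolding q_def using qpos by simp
    show "max 0 (t - c) \<le> q n t" unfolding q_def by (intro real_le_rsqrt) simp
    show "q n t \<le> max 0 (t - c) + \<delta> n"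
      unfolding q_def by (rule sqrt_sum_squares_le_sum) (use \<delta>[of n] in auto)
  qed
  have d: "(b n has_real_derivative b' n t) (at t)" for n t
  proof -
    have eq: "inverse s / 2 * (2 * m) - 0 = m / s" for s m :: real by (simp add: inverse_eq_divide)
    have 1: "((\<lambda>s. s - c) has_real_derivative 1) (at t)" by (auto intro!: derivative_eq_intros)
    have "((\<lambda>s. max 0 (s - c) ^ 2) has_real_derivative 2 * max 0 (t - c)) (at t)"
      using DERIV_chain2[OF DERIV_max0_power[of 1 "t - c"] 1] by (simp add: numeral_2_eq_2)
    then have 2: "((\<lambda>s. max 0 (s - c) ^ 2 + (\<delta> n)\<^sup>2) has_real_derivative 2 * max 0 (t - c)) (at t)"
      using DERIV_add[OF _ DERIV_const] by fastforce
    have "((\<lambda>s. sqrt (max 0 (s - c) ^ 2 + (\<delta> n)\<^sup>2)) has_real_derivative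
        inverse (sqrt (max 0 (t - c) ^ 2 + (\<delta> n)\<^sup>2)) / 2 * (2 * max 0 (t - c))) (at t)"
      by (rule DERIV_chain2[where f = sqrt, OF DERIV_real_sqrt[OF qpos] 2])
    then have "((\<lambda>s. sqrt (max 0 (s - c) ^ 2 + (\<delta> n)\<^sup>2) - \<delta> n) has_real_derivative
        inverse (sqrt (max 0 (t - c) ^ 2 + (\<delta> n)\<^sup>2)) / 2 * (2 * max 0 (t - c)) - 0) (at t)"
      by (rule DERIV_diff[OF _ DERIV_const])
    then show ?thesis unfolding b_def[abs_def] b'_def q_def
      using eq[of "sqrt (max 0 (t - c) ^ 2 + (\<delta> n)\<^sup>2)" "max 0 (t - c)"] by (simp only:)
  qed
  have cq: "continuous_on UNIV (q n)" for n unfolding q_def by (intro continuous_intros)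
  have cb': "continuous_on UNIV (b' n)" for n
    unfolding b'_def using q(1)[of n] by (intro continuous_intros cq) (auto simp: less_imp_neq[symmetric])
  have b': "0 \<le> b' n t" "b' n t \<le> 1" for n t
    using q(1,2)[where n=n and t=t] by (simp_all add: b'_def)
  have b0: "b n 0 = 0" for n using c \<delta>[of n] by (simp add: b_def q_def)
  have le: "TV (\<lambda>x. b n (w x)) + TV (\<lambda>x. w x - b n (w x)) \<le> TV w" for n
    by (rule TV_split_C1[OF w z d cb' b' b0])
  have bb: "0 \<le> b n t" "b n t \<le> max 0 (t - c)" "max 0 (t - c) \<le> b n t + \<delta> n" for n t
  proof -
    show "0 \<le> b n t" unfolding b_def q_def using \<delta>[of n] by (simp add: real_le_rsqrt)
  qed (use q(2,3)[where n=n and t=t] in \<open>simp_all add: b_def\<close>)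
  have lim: "(\<lambda>n. b n t) \<longlonglongrightarrow> max 0 (t - c)" for t
  proof (rule tendsto_sandwich)
    have "\<delta> \<longlonglongrightarrow> 0" unfolding \<delta>_def[abs_def] by (rule LIMSEQ_Suc[OF lim_1_over_n])
    then show "(\<lambda>n. max 0 (t - c) - \<delta> n) \<longlonglongrightarrow> max 0 (t - c)" by (auto intro!: tendsto_eq_intros)
    show "eventually (\<lambda>n. max 0 (t - c) - \<delta> n \<le> b n t) sequentially"
      using bb(3)[where t=t] by (intro always_eventually) (simp add: algebra_simps)
    show "eventually (\<lambda>n. b n t \<le> max 0 (t - c)) sequentially"
      using bb(2)[where t=t] by (intro always_eventually) simp
  qed (rule tendsto_const)
  have [measurable]: "b n \<in> borel_measurable borel" for n unfolding b_def[abs_def] q_def by measurable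
  note [measurable] = borel_measurable_integrable[OF w]
  have wl[measurable]: "w \<in> borel_measurable lebesgue" by (rule measurable_completion) measurable
  have il: "integrable lebesgue (\<lambda>x. \<bar>w x\<bar>)" using w by (simp add: integrable_completion)
  have minmax: "min s c = s - max 0 (s - c)" for s by (simp add: min_def max_def)
  show ?thesis
  proof (rule TV_add_lsc[OF _ _ le])
    fix \<phi> assume \<phi>: "\<phi> \<in> test_fields"
    show "(\<lambda>n. \<integral>x. b n (w x) * divergence \<phi> x \<partial>lebesgue) \<longlonglongrightarrow> (\<integral>x. max 0 (w x - c) * divergence \<phi> x \<partial>lebesgue)"
    proof (rule pairing_tendsto_dominated[OF \<phi>])
      have "\<bar>b n (w x)\<bar> \<le> \<bar>w x\<bar>" for n x using bb(1,2)[where n=n and t="w x"] c by (auto simp: max_def split: if_splits)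
      then show "AE x in lebesgue. \<bar>b n (w x)\<bar> \<le> \<bar>w x\<bar>" for n by simp
    qed (use lim il in auto)
    show "(\<lambda>n. \<integral>x. (w x - b n (w x)) * divergence \<phi> x \<partial>lebesgue) \<longlonglongrightarrow> (\<integral>x. min (w x) c * divergence \<phi> x \<partial>lebesgue)"
    proof (rule pairing_tendsto_dominated[OF \<phi>])
      have "\<bar>w x - b n (w x)\<bar> \<le> \<bar>w x\<bar>" for n x using bb(1,2)[where n=n and t="w x"] c by (auto simp: max_def split: if_splits)
      then show "AE x in lebesgue. \<bar>w x - b n (w x)\<bar> \<le> \<bar>w x\<bar>" for n by simp
      show "AE x in lebesgue. (\<lambda>n. w x - b n (w x)) \<longlonglongrightarrow> min (w x) c"
        unfolding minmax by (intro AE_I2 tendsto_intros lim)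
    qed (use il in auto)
  qed
qed

section \<open>The coarea inequality\<close>

text \<open>Each value w(x) is the length of [0, w(x)), and the order of integration is exchanged.
  On both sides only the positive part of \<open>w\<close> counts, since \<open>ennreal\<close>
  sends negative reals to 0.\<close>

lemma layer_cake:
  fixes w :: "'a::euclidean_space \<Rightarrow> real"
  assumes [measurable]: "w \<in> borel_measurable borel"
  shows "(\<integral>\<^sup>+x. ennreal (w x) \<partial>lborel) = (\<integral>\<^sup>+t. indicator {0..} t * emeasure lborel {x. w x > t} \<partial>lborel)"
proof -
  have "(\<integral>\<^sup>+x. ennreal (w x) \<partial>lborel) = (\<integral>\<^sup>+x. (\<integral>\<^sup>+t. indicator {0..<w x} t \<partial>lborel) \<partial>lborel)"
  proof (rule nn_integral_cong)
    show "ennreal (w x) = (\<integral>\<^sup>+t. indicator {0..<w x} t \<partial>lborel)" for x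
      by (cases "w x \<ge> 0") (auto simp: ennreal_neg)
  qed
  also have "\<dots> = (\<integral>\<^sup>+x. (\<integral>\<^sup>+t. indicator {0..} t * indicator {x. w x > t} x \<partial>lborel) \<partial>lborel)"
    by (intro nn_integral_cong) (auto split: split_indicator)
  also have "\<dots> = (\<integral>\<^sup>+t. (\<integral>\<^sup>+x. indicator {0..} t * indicator {x. w x > t} x \<partial>lborel) \<partial>lborel)"
    by (rule lborel_pair.Fubini'[symmetric]) measurable
  also have "\<dots> = (\<integral>\<^sup>+t. indicator {0..} t * emeasure lborel {x. w x > t} \<partial>lborel)"
    by (intro nn_integral_cong) (simp add: nn_integral_cmult)
  finally show ?thesis .
qed

text \<open>A telescoping argument: adding the finite integral of M / h over [0, T] turns the left
  side into the integral of M / h over [h, T + h]. This exceeds the added integral at most by the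
  part over [T, T + h], where M / h is at most B / h on an interval of length h.\<close>

lemma nn_integral_mono_difference:
  fixes M :: "real \<Rightarrow> real"
  assumes M: "mono M" "\<And>t. 0 \<le> M t" "\<And>t. M t \<le> B" and h: "h > 0" and T: "T \<ge> 0"
  shows "(\<integral>\<^sup>+t. ennreal ((M (t + h) - M t) / h) * indicator {0..T} t \<partial>lborel) \<le> ennreal B"
proof -
  have [measurable]: "M \<in> borel_measurable borel" using M(1) by (rule borel_measurable_mono)
  define m where "m t = ennreal (M t / h)" for t
  have [measurable]: "m \<in> borel_measurable borel" unfolding m_def[abs_def] by measurable
  have mB: "m t \<le> ennreal (B / h)" for t unfolding m_def using M h by (intro ennreal_leI divide_right_mono) auto
  have B: "0 \<le> B" using M(2,3)[of 0] by linarith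
  let ?I = "\<integral>\<^sup>+t. m t * indicator {0..T} t \<partial>lborel"
  have "?I \<le> (\<integral>\<^sup>+t. ennreal (B / h) * indicator {0..T} t \<partial>lborel)"
    by (intro nn_integral_mono mult_right_mono mB) auto
  also have "\<dots> < \<infinity>" using T by (simp add: nn_integral_cmult ennreal_mult_less_top)
  finally have fin: "?I \<noteq> \<infinity>" by simp
  have "(\<integral>\<^sup>+t. ennreal ((M (t + h) - M t) / h) * indicator {0..T} t \<partial>lborel) + ?I
      = (\<integral>\<^sup>+t. ennreal ((M (t + h) - M t) / h) * indicator {0..T} t + m t * indicator {0..T} t \<partial>lborel)"
    by (rule nn_integral_add[symmetric]) measurable
  also have "\<dots> = (\<integral>\<^sup>+t. m (h + t) * indicator {h..T + h} (h + t) \<partial>lborel)"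
  proof (intro nn_integral_cong)
    fix t
    have "M t \<le> M (t + h)" using M(1) h by (simp add: mono_def)
    then have "ennreal ((M (t + h) - M t) / h) + m t = m (h + t)"
      unfolding m_def using M(2) h
      by (subst ennreal_plus[symmetric]) (auto simp: diff_divide_distrib add.commute divide_right_mono)
    then show "ennreal ((M (t + h) - M t) / h) * indicator {0..T} t + m t * indicator {0..T} t
        = m (h + t) * indicator {h..T + h} (h + t)"
      by (auto split: split_indicator)
  qed
  also have "\<dots> = (\<integral>\<^sup>+t. m t * indicator {h..T + h} t \<partial>lborel)"
    by (rule nn_integral_lborel_translate) measurable
  also have "\<dots> \<le> (\<integral>\<^sup>+t. m t * indicator {0..T} t + ennreal (B / h) * indicator {T..T + h} t \<partial>lborel)"
    using h mB by (intro nn_integral_mono) (auto split: split_indicator)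
  also have "\<dots> = ?I + ennreal B"
    using h T B by (simp add: nn_integral_add nn_integral_cmult ennreal_mult[symmetric])
  finally show ?thesis using fin by (simp add: add.commute ennreal_add_left_cancel_le)
qed

text \<open>The measurable majorant \<open>L\<close> takes the place of the perimeter of the level
  sets, so that measurability of this perimeter in t does not have to be established. It is the
  lower limit of the difference quotients of the total variation of the truncations.\<close>

lemma coarea_inequality:
  fixes w :: "real^2 \<Rightarrow> real"
  assumes w: "integrable lborel w" and z: "\<And>x. norm x > R \<Longrightarrow> w x = 0" and w0: "\<And>x. w x \<ge> 0"
    and fin: "TV w < \<infinity>"
  obtains L :: "real \<Rightarrow> ennreal" where "L \<in> borel_measurable borel"
    "\<And>t. t \<ge> 0 \<Longrightarrow> Per {x. w x > t} \<le> L t" "(\<integral>\<^sup>+t. L t \<partial>lborel) \<le> TV w"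
proof -
  note [measurable] = borel_measurable_integrable[OF w]
  have wl[measurable]: "w \<in> borel_measurable lebesgue" by (rule measurable_completion) measurable
  have im: "integrable lborel (\<lambda>x. min (w x) t)" if "t \<ge> 0" for t
    by (rule Bochner_Integration.integrable_bound[OF w]) (use w0 that in auto)
  have split: "TV (\<lambda>x. max 0 (min (w x) t - s)) + TV (\<lambda>x. min (w x) s) \<le> TV (\<lambda>x. min (w x) t)"
    if "0 \<le> s" "s \<le> t" for s t
  proof -
    have "min (min (w x) t) s = min (w x) s" for x using that by auto
    then show ?thesis using TV_split[OF im[of t], of R s] z that by simp
  qed
  have le: "TV (\<lambda>x. min (w x) t) \<le> TV w" if "t \<ge> 0" for t
    using TV_split[OF w z that] by (meson order_trans add_increasing zero_le order_refl)
  \<comment> \<open>\<open>max 0 t\<close>, because \<open>min (w x) t\<close> is not integrable for \<open>t < 0\<close>.\<close>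
  define M where "M t = enn2real (TV (\<lambda>x. min (w x) (max 0 t)))" for t
  have M: "ennreal (M t) = TV (\<lambda>x. min (w x) t)" if "t \<ge> 0" for t
    using le_less_trans[OF le[OF that] fin] that by (simp add: M_def max_def)
  have M0: "M t \<ge> 0" for t by (simp add: M_def)
  have MB: "M t \<le> enn2real (TV w)" for t
    unfolding M_def using fin by (intro enn2real_mono le) auto
  have Mm: "mono M"
  proof (rule monoI)
    fix s t :: real assume "s \<le> t"
    then have "max 0 s \<le> max 0 t" by auto
    then have "TV (\<lambda>x. min (w x) (max 0 s)) \<le> TV (\<lambda>x. min (w x) (max 0 t))"
      using split[of "max 0 s" "max 0 t"] by (meson order_trans add_increasing zero_le order_refl max.cobounded1)
    then show "M s \<le> M t"
      unfolding M_def using le_less_trans[OF le fin, of "max 0 t"] by (intro enn2real_mono) auto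
  qed
  have [measurable]: "M \<in> borel_measurable borel" using Mm by (rule borel_measurable_mono)
  define h where "h n = 1 / real (Suc n)" for n
  have h: "h n > 0" for n by (simp add: h_def)
  \<comment> \<open>The cut-off at \<open>real n\<close> keeps the integrals finite and disappears in the lower limit.\<close>
  define D where "D n t = ennreal ((M (t + h n) - M t) / h n) * indicator {0..real n} t" for n t
  have [measurable]: "D n \<in> borel_measurable borel" for n unfolding D_def[abs_def] by measurable
  define L where "L t = liminf (\<lambda>n. D n t)" for t
  show ?thesis
  proof (rule that)
    show "L \<in> borel_measurable borel" unfolding L_def[abs_def] by measurable
    have "(\<integral>\<^sup>+t. L t \<partial>lborel) \<le> liminf (\<lambda>n. \<integral>\<^sup>+t. D n t \<partial>lborel)"
      unfolding L_def by (rule nn_integral_liminf) measurable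
    also have "\<dots> \<le> liminf (\<lambda>n::nat. ennreal (enn2real (TV w)))"
      unfolding D_def
      by (intro Liminf_mono always_eventually allI nn_integral_mono_difference[OF Mm M0 MB h]) simp
    also have "\<dots> = TV w" using fin by (simp add: Liminf_const)
    finally show "(\<integral>\<^sup>+t. L t \<partial>lborel) \<le> TV w" .
    fix t :: real assume t: "t \<ge> 0"
    \<comment> \<open>The slice of \<open>w\<close> between t and t + h, rescaled to height 1. It
      equals min((n + 1) max(0, w - t), 1) and tends to the indicator of the strict level set; it is
      0 where w = t.\<close>
    define V where "V n x = real (Suc n) * max 0 (min (w x) (t + h n) - t)" for n x
    have "TV (V n) \<le> ennreal ((M (t + h n) - M t) / h n)" for n
    proof -
      have *: "TV (\<lambda>x. max 0 (min (w x) (t + h n) - t)) + ennreal (M t) \<le> ennreal (M (t + h n))"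
        using split[of t "t + h n"] h[of n] t by (simp add: M)
      have "TV (\<lambda>x. max 0 (min (w x) (t + h n) - t)) \<noteq> \<infinity>"
        using neq_top_trans[OF _ *] by (auto simp: ennreal_add_eq_top)
      then obtain a where a: "TV (\<lambda>x. max 0 (min (w x) (t + h n) - t)) = ennreal a" "a \<ge> 0"
        by (cases "TV (\<lambda>x. max 0 (min (w x) (t + h n) - t))") auto
      have "ennreal (a + M t) \<le> ennreal (M (t + h n))"
        using * a M0[of t] by (simp add: ennreal_plus)
      then have "a \<le> M (t + h n) - M t"
        using M0[of "t + h n"] by (simp add: ennreal_le_iff)
      then have "real (Suc n) * a \<le> (M (t + h n) - M t) / h n"
        by (simp add: h_def mult.commute mult_right_mono)
      then have "ennreal (real (Suc n)) * ennreal a \<le> ennreal ((M (t + h n) - M t) / h n)"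
        using a(2) by (subst ennreal_mult[symmetric]) (auto intro: ennreal_leI)
      then show ?thesis
        unfolding V_def TV_scale[OF of_nat_0_le_iff] a(1) .
    qed
    then have VD: "eventually (\<lambda>n. TV (V n) \<le> D n t) sequentially"
    proof -
      obtain N :: nat where "real N \<ge> t" using real_arch_simple by blast
      then have "TV (V n) \<le> D n t" if "n \<ge> N" for n
        using that t \<open>\<And>n. TV (V n) \<le> ennreal ((M (t + h n) - M t) / h n)\<close>[of n] by (simp add: D_def)
      then show ?thesis by (auto simp: eventually_sequentially)
    qed
    have "Per {x. w x > t} \<le> liminf (\<lambda>n. TV (V n))"
      unfolding Per_def
    proof (rule TV_lsc)
      fix \<phi> assume \<phi>: "\<phi> \<in> test_fields"
      show "(\<lambda>n. \<integral>x. V n x * divergence \<phi> x \<partial>lebesgue)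
          \<longlonglongrightarrow> (\<integral>x. indicat_real {x. w x > t} x * divergence \<phi> x \<partial>lebesgue)"
      proof (rule pairing_tendsto_dominated[OF \<phi>])
        show "V n \<in> borel_measurable lebesgue" for n unfolding V_def[abs_def] by measurable
        show "indicat_real {x. w x > t} \<in> borel_measurable lebesgue" by measurable
        have "V n x = min (real (Suc n) * max 0 (w x - t)) 1" for n x
        proof -
          have "max 0 (min (w x) (t + h n) - t) = min (max 0 (w x - t)) (h n)" using h[of n] by auto
          also have "real (Suc n) * \<dots> = min (real (Suc n) * max 0 (w x - t)) (real (Suc n) * h n)"
            by (subst min_mult_distrib_left) simp
          also have "real (Suc n) * h n = 1" by (simp add: h_def)
          finally show ?thesis by (simp add: V_def)
        qed
        note Veq = this
        show "AE x in lebesgue. \<bar>V n x\<bar> \<le> 1" for n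
          unfolding Veq by (intro AE_I2) auto
        show "AE x in lebesgue. (\<lambda>n. V n x) \<longlonglongrightarrow> indicat_real {x. w x > t} x"
        proof (rule AE_I2)
          fix x
          show "(\<lambda>n. V n x) \<longlonglongrightarrow> indicat_real {x. w x > t} x"
          proof (cases "w x > t")
            case True
            obtain N :: nat where N: "1 < real N * (w x - t)" using True reals_Archimedean3[of "w x - t"] by auto
            have "V n x = 1" if "n \<ge> N" for n
            proof -
              have "real N * (w x - t) \<le> real (Suc n) * (w x - t)" using that True by (intro mult_right_mono) auto
              then have "1 \<le> real (Suc n) * (w x - t)" using N by linarith
              moreover have "max 0 (w x - t) = w x - t" using True by simp
              ultimately have "1 \<le> real (Suc n) * max 0 (w x - t)" by (simp only:)
              then show ?thesis unfolding Veq by (rule min_absorb2)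
            qed
            then show ?thesis using True
              by (intro tendsto_eventually) (auto simp: eventually_sequentially)
          qed (simp add: Veq)
        qed
      qed (rule disjI2, rule refl)
    qed
    also have "\<dots> \<le> L t" unfolding L_def using VD by (rule Liminf_mono)
    finally show "Per {x. w x > t} \<le> L t" .
  qed
qed

section \<open>Optimality of the level sets\<close>

lemma Per_cong_AE:
  assumes "A \<in> sets lebesgue" "B \<in> sets lebesgue" "AE x in lebesgue. x \<in> A \<longleftrightarrow> x \<in> B"
  shows "Per A = Per B"
  unfolding Per_def
proof (rule TV_cong_AE)
  show "AE x in lebesgue. indicat_real A x = indicat_real B x"
    using assms(3) by eventually_elim (auto simp: indicator_def)
qed (use assms in auto)

lemma T_functional_cong_AE:
  assumes "A \<in> sets lebesgue" "B \<in> sets lebesgue" "AE x in lebesgue. x \<in> A \<longleftrightarrow> x \<in> B"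
  shows "T_functional \<Omega>m A = T_functional \<Omega>m B"
  unfolding T_functional_def using Per_cong_AE[OF assms] emeasure_eq_AE[OF assms(3,1,2)] by simp

text \<open>The coefficient |E| / |\<Omega>m| is forced by the vanishing integral. It turns the
  second perimeter term into Per(\<Omega>m) / |\<Omega>m| times |E|, so subadditivity of
  \<open>TV\<close> gives exactly the functional. Since \<open>E\<close> avoids
  \<open>\<Omega>m\<close> up to a null set, the value on \<open>\<Omega>s\<close> is 1.\<close>

lemma competitor_function:
  assumes \<Omega>: "\<Omega> \<in> sets lebesgue" "emeasure lebesgue \<Omega> < \<infinity>"
    and \<Omega>m: "\<Omega>m \<in> sets lebesgue" "ae_subset \<Omega>m \<Omega>" "emeasure lebesgue \<Omega>m > 0"
    and E: "T_competitor \<Omega> \<Omega>s \<Omega>m E" "T_functional \<Omega>m E < \<infinity>"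
  defines "v \<equiv> \<lambda>x. indicat_real E x - measure lebesgue E / measure lebesgue \<Omega>m * indicat_real \<Omega>m x"
  shows "v \<in> BV_diamond_1 \<Omega> \<Omega>s" and "TV v \<le> T_functional \<Omega>m E"
proof -
  have Es[measurable]: "E \<in> sets lebesgue" and Ess: "AE x in lebesgue. x \<in> \<Omega>s \<longrightarrow> x \<in> E"
    and E\<Omega>: "AE x in lebesgue. x \<in> E \<longrightarrow> x \<in> \<Omega> \<and> x \<notin> \<Omega>m"
    using E(1) by (auto simp: T_competitor_def ae_subset_def)
  note [measurable] = \<Omega>(1) \<Omega>m(1)
  have \<Omega>m\<Omega>: "AE x in lebesgue. x \<in> \<Omega>m \<longrightarrow> x \<in> \<Omega>" using \<Omega>m(2) by (simp add: ae_subset_def)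
  have "emeasure lebesgue E \<le> emeasure lebesgue \<Omega>"
    by (rule emeasure_mono_AE) (use E\<Omega> \<Omega>(1) in auto)
  then have fE: "emeasure lebesgue E < \<infinity>" using \<Omega>(2) by (rule le_less_trans)
  have "emeasure lebesgue \<Omega>m \<le> emeasure lebesgue \<Omega>"
    by (rule emeasure_mono_AE) (use \<Omega>m\<Omega> \<Omega>(1) in auto)
  then have fm: "emeasure lebesgue \<Omega>m < \<infinity>" using \<Omega>(2) by (rule le_less_trans)
  have eE: "emeasure lebesgue E = ennreal (measure lebesgue E)"
    and em: "emeasure lebesgue \<Omega>m = ennreal (measure lebesgue \<Omega>m)"
    using fE fm by (intro emeasure_eq_ennreal_measure; simp)+
  have m0: "measure lebesgue \<Omega>m > 0" using \<Omega>m(3) em by simp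
  define c where "c = measure lebesgue E / measure lebesgue \<Omega>m"
  have c: "c \<ge> 0" by (simp add: c_def)
  have v: "v = (\<lambda>x. indicat_real E x + - (c * indicat_real \<Omega>m x))" by (simp add: v_def c_def)
  have iE: "integrable lebesgue (indicat_real E)" and im: "integrable lebesgue (indicat_real \<Omega>m)"
    using fE fm by (simp_all add: integrable_indicator_iff)
  then have iv: "integrable lebesgue v" unfolding v by simp
  have "TV v \<le> TV (indicat_real E) + TV (\<lambda>x. - (c * indicat_real \<Omega>m x))"
    unfolding v using iE im by (intro TV_add) auto
  also have "\<dots> = Per E + ennreal c * Per \<Omega>m"
    unfolding TV_uminus TV_scale[OF c] Per_def ..
  also have "ennreal c = emeasure lebesgue E / emeasure lebesgue \<Omega>m"
    unfolding eE em c_def using m0 by (simp add: divide_ennreal)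
  also have "Per E + emeasure lebesgue E / emeasure lebesgue \<Omega>m * Per \<Omega>m = T_functional \<Omega>m E"
    unfolding T_functional_def by (simp add: divide_ennreal_def mult_ac)
  finally show TVv: "TV v \<le> T_functional \<Omega>m E" .
  have v0: "AE x in lebesgue. x \<notin> \<Omega> \<longrightarrow> v x = 0"
    using E\<Omega> \<Omega>m\<Omega> by eventually_elim (auto simp: v)
  have "(LINT x:\<Omega>|lebesgue. v x) = (\<integral>x. v x \<partial>lebesgue)"
    unfolding set_lebesgue_integral_def
  proof (rule integral_cong_AE)
    show "AE x in lebesgue. indicat_real \<Omega> x *\<^sub>R v x = v x"
      using v0 by eventually_elim (auto simp: indicator_def)
  qed (use iv in auto)
  also have "\<dots> = measure lebesgue E - c * measure lebesgue \<Omega>m"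
    unfolding v using iE im by simp
  also have "\<dots> = 0" using m0 by (simp add: c_def)
  finally have i0: "(LINT x:\<Omega>|lebesgue. v x) = 0" .
  have v1: "AE x in lebesgue. x \<in> \<Omega>s \<longrightarrow> v x = 1"
    using Ess E\<Omega> by eventually_elim (auto simp: v)
  show "v \<in> BV_diamond_1 \<Omega> \<Omega>s"
    unfolding BV_diamond_1_def BV_def using iv le_less_trans[OF TVv E(2)] i0 v1 v0 by simp
qed

lemma measurable_emeasure_superlevel:
  fixes w :: "'a::euclidean_space \<Rightarrow> real"
  assumes [measurable]: "w \<in> borel_measurable borel"
  shows "(\<lambda>t. emeasure lborel {x. w x > t}) \<in> borel_measurable borel"
proof -
  have "(\<lambda>t. \<integral>\<^sup>+x. indicator {x. w x > t} x \<partial>lborel) \<in> borel_measurable borel" by measurable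
  then show ?thesis by simp
qed

lemma ennreal_le_divideD:
  fixes a b c :: ennreal
  assumes "c \<le> a / b" "0 < b" "b < \<infinity>"
  shows "c * b \<le> a"
proof -
  have "c * b \<le> b * (a / b)" using mult_left_mono[OF assms(1), of b] by (simp add: mult.commute)
  also have "\<dots> = a * b / b" by (simp only: ennreal_times_divide mult.commute)
  also have "\<dots> = a" using assms by (intro ennreal_mult_divide_eq) auto
  finally show ?thesis .
qed

lemma AE_interval_exists:
  fixes a b :: real
  assumes "AE t in lborel. P t" "a < b"
  obtains t where "a < t" "t < b" "P t"
proof (rule ccontr)
  assume "\<not> thesis"
  then have "AE t in lborel. t \<notin> {a<..<b}"
    using assms(1) that by (auto elim!: eventually_mono)
  then have "{a<..<b} \<in> null_sets lborel" by (subst AE_iff_null_sets) auto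
  then show False using assms(2) by (simp add: null_sets_def)
qed

theorem theorem4p3:
  fixes \<Omega> \<Omega>s \<Omega>m :: "(real^2) set" and u :: "real^2 \<Rightarrow> real"
  assumes "open \<Omega>" and "connected \<Omega>" and "\<Omega> \<noteq> {}" and "bounded \<Omega>" and "Per \<Omega> < \<infinity>"
    and "\<Omega>s \<in> sets lebesgue" and "ae_subset \<Omega>s \<Omega>" and "Per \<Omega>s < \<infinity>"
    and "emeasure lebesgue \<Omega>s > 0" and "emeasure lebesgue (\<Omega> - \<Omega>s) > 0"
    and "is_arg_min TV (\<lambda>v. v \<in> BV_diamond_1 \<Omega> \<Omega>s) u"
    and "cheeger_set (\<Omega> - {x. u x > 0}) \<Omega>m"
  shows "(\<exists>\<Omega>1 \<in> sets borel.
            is_arg_min (T_functional \<Omega>m) (T_competitor \<Omega> \<Omega>s \<Omega>m) \<Omega>1 \<and>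
            is_arg_min TV (\<lambda>v. v \<in> BV_diamond_1 \<Omega> \<Omega>s)
              (\<lambda>x. indicat_real \<Omega>1 x
                   - measure lebesgue \<Omega>1 / measure lebesgue \<Omega>m * indicat_real \<Omega>m x))
       \<and> (\<forall>t::real. 0 \<le> t \<and> t < 1 \<longrightarrow>
            is_arg_min (T_functional \<Omega>m) (T_competitor \<Omega> \<Omega>s \<Omega>m) {x. u x > t})"
proof -
  \<comment> \<open>This is the \<lambda> of the overview, the minimal quotient in the Cheeger
    problem.\<close>
  define ratio where "ratio = Per \<Omega>m / emeasure lebesgue \<Omega>m"
  have uBV: "u \<in> BV_diamond_1 \<Omega> \<Omega>s"
    using assms(11) unfolding is_arg_min_def by (rule conjunct1)
  have umin: "TV u \<le> TV v" if "v \<in> BV_diamond_1 \<Omega> \<Omega>s" for v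
    using assms(11) that unfolding is_arg_min_def not_less[symmetric] by blast
  have u: "integrable lebesgue u" "TV u < \<infinity>" "(LINT x:\<Omega>|lebesgue. u x) = 0"
    and us: "AE x in lebesgue. x \<in> \<Omega>s \<longrightarrow> u x = 1" and u\<Omega>: "AE x in lebesgue. x \<notin> \<Omega> \<longrightarrow> u x = 0"
    using uBV unfolding BV_diamond_1_def BV_def mem_Collect_eq by blast+
  have \<Omega>m: "\<Omega>m \<in> sets lebesgue" "emeasure lebesgue \<Omega>m > 0"
    and \<Omega>mu: "ae_subset \<Omega>m (\<Omega> - {x. u x > 0})"
    using assms(12) unfolding cheeger_set_def is_arg_min_def by blast+
  have \<Omega>m\<Omega>u: "AE x in lebesgue. x \<in> \<Omega>m \<longrightarrow> x \<in> \<Omega> \<and> \<not> 0 < u x"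
    using \<Omega>mu by (simp add: ae_subset_def)
  have cheeger: "ratio \<le> Per E / emeasure lebesgue E"
    if "E \<in> sets lebesgue" "ae_subset E (\<Omega> - {x. u x > 0})" "emeasure lebesgue E > 0" for E
    using assms(12) that unfolding cheeger_set_def is_arg_min_def ratio_def not_less[symmetric] by blast
  have \<Omega>m\<Omega>: "ae_subset \<Omega>m \<Omega>" using \<Omega>m\<Omega>u by (auto simp: ae_subset_def elim: eventually_mono)
  have \<Omega>s: "\<Omega> \<in> sets lebesgue" using assms(1) by auto
  have \<Omega>f: "emeasure lebesgue \<Omega> < \<infinity>"
    using emeasure_bounded_finite[OF assms(4)] by (simp add: assms(1) borel_open)
  obtain R where R: "\<Omega> \<subseteq> cball 0 R" using assms(4) unfolding bounded_iff by (auto simp: subset_eq)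

  \<comment> \<open>A Borel representative and its positive and negative parts\<close>
  obtain u' where u'[measurable]: "u' \<in> borel_measurable lborel" and uu': "AE x in lborel. u x = u' x"
    using completion_ex_borel_measurable_real[OF borel_measurable_integrable[OF u(1)]] by blast
  \<comment> \<open>A Borel representative that vanishes everywhere outside a ball.\<close>
  define w where "w x = u' x * indicator (cball 0 R) x" for x
  have [measurable]: "cball (0::real^2) R \<in> sets borel" by (simp add: borel_closed)
  have w[measurable]: "w \<in> borel_measurable borel" unfolding w_def[abs_def] using u' by measurable
  have wl[measurable]: "w \<in> borel_measurable lebesgue" by (rule measurable_completion) (use w in simp)
  have uw: "AE x in lebesgue. u x = w x"
    using AE_completion[OF uu'] u\<Omega> by eventually_elim (use R in \<open>auto simp: w_def indicator_def\<close>)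
  have ul[measurable]: "u \<in> borel_measurable lebesgue" using u(1) by auto
  have wz: "w x = 0" if "norm x > R" for x using that by (simp add: w_def)
  have iwl: "integrable lebesgue w" using u(1) integrable_cong_AE[OF ul wl uw] by simp
  then have iw: "integrable lborel w" using w by (simp add: integrable_completion)
  have TVw: "TV u = TV w" by (rule TV_cong_AE[OF ul wl uw])
  define p where "p x = max 0 (w x)" for x
  define m where "m x = max 0 (- w x)" for x
  have [measurable]: "p \<in> borel_measurable borel" "m \<in> borel_measurable borel"
    unfolding p_def[abs_def] m_def[abs_def] by measurable
  have ip: "integrable lborel p" and im: "integrable lborel m"
    unfolding p_def[abs_def] m_def[abs_def] using iw by auto
  \<comment> \<open>Truncation at level 0 separates the two signs of \<open>w\<close>.\<close>
  have "min (w x) 0 = - m x" for x by (simp add: m_def)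
  then have TVpm: "TV p + TV m \<le> TV w"
    using TV_split[OF iw wz, of R 0] TV_uminus[of m] by (simp add: p_def[abs_def])
  then have fp: "TV p < \<infinity>" and fm: "TV m < \<infinity>"
    using u(2) unfolding TVw by (auto simp: less_top ennreal_add_eq_top dest: neq_top_trans[rotated])
  obtain Lp where Lp[measurable]: "Lp \<in> borel_measurable borel"
    and PLp: "\<And>t. t \<ge> 0 \<Longrightarrow> Per {x. p x > t} \<le> Lp t" and ILp: "(\<integral>\<^sup>+t. Lp t \<partial>lborel) \<le> TV p"
    using coarea_inequality[OF ip _ _ fp, of R] wz by (auto simp: p_def)
  obtain Lm where Lm[measurable]: "Lm \<in> borel_measurable borel"
    and PLm: "\<And>t. t \<ge> 0 \<Longrightarrow> Per {x. m x > t} \<le> Lm t" and ILm: "(\<integral>\<^sup>+t. Lm t \<partial>lborel) \<le> TV m"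
    using coarea_inequality[OF im _ _ fm, of R] wz by (auto simp: m_def)

  \<comment> \<open>The Cheeger inequality on the level sets of the negative part\<close>
  have borel_leb: "A \<in> sets lebesgue" if "A \<in> sets borel" for A :: "(real^2) set" using that by simp
  define E where "E t = {x. w x > t}" for t
  have Eb[measurable]: "E t \<in> sets borel" for t unfolding E_def by measurable
  have pE: "{x. p x > t} = E t" if "t \<ge> 0" for t unfolding E_def p_def using that by auto

  \<comment> \<open>For \<open>t \<ge> 0\<close> the set where m > t lies, up to a null set, in
    \<Omega> and outside the set where u > 0, hence it competes in the Cheeger problem unless it is
    null. The inequality is multiplied out so that it can be integrated in t.\<close>
  have ratio_m: "ratio * emeasure lborel {x. m x > t} \<le> Lm t" if t: "t \<ge> 0" for t
  proof (cases "emeasure lborel {x. m x > t} = 0")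
    case False
    let ?S = "{x. m x > t}"
    have S[measurable]: "?S \<in> sets borel" by measurable
    have "?S \<subseteq> cball 0 R" using wz t by (force simp: m_def not_le[symmetric])
    then have "emeasure lborel ?S < \<infinity>"
      by (meson bounded_cball bounded_subset emeasure_bounded_finite)
    moreover have "ae_subset ?S (\<Omega> - {x. u x > 0})"
      unfolding ae_subset_def using uw u\<Omega> by eventually_elim (use t in \<open>auto simp: m_def\<close>)
    ultimately have "ratio * emeasure lborel ?S \<le> Per ?S"
      using cheeger[of ?S] False S by (intro ennreal_le_divideD) (auto simp: zero_less_iff_neq_zero)
    then show ?thesis using PLm[OF t] by (rule order_trans)
  qed simp
  have mlm: "(\<lambda>t. emeasure lborel {x. m x > t}) \<in> borel_measurable borel"
    by (rule measurable_emeasure_superlevel) measurable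
  have plm: "(\<lambda>t. emeasure lborel (E t)) \<in> borel_measurable borel"
    unfolding E_def by (rule measurable_emeasure_superlevel) measurable
  note [measurable] = mlm plm
  have "ratio * (\<integral>\<^sup>+x. ennreal (m x) \<partial>lborel) = (\<integral>\<^sup>+t. ratio * (indicator {0..} t * emeasure lborel {x. m x > t}) \<partial>lborel)"
    unfolding layer_cake[OF \<open>m \<in> borel_measurable borel\<close>] by (rule nn_integral_cmult[symmetric]) measurable
  also have "\<dots> \<le> (\<integral>\<^sup>+t. Lm t \<partial>lborel)"
    using ratio_m by (intro nn_integral_mono) (auto split: split_indicator)
  finally have ratio_m_le: "ratio * (\<integral>\<^sup>+x. ennreal (m x) \<partial>lborel) \<le> TV m" using ILm by (rule order_trans)

  \<comment> \<open>The mean-zero constraint enters here: \<open>w\<close> vanishes almost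
    everywhere outside \<Omega>, so \<open>p\<close> and \<open>m\<close> have equal
    integrals.\<close>
  have "(\<integral>x. w x \<partial>lebesgue) = (LINT x:\<Omega>|lebesgue. u x)"
    unfolding set_lebesgue_integral_def
  proof (rule integral_cong_AE)
    show "AE x in lebesgue. w x = indicat_real \<Omega> x *\<^sub>R u x"
      using uw u\<Omega> by eventually_elim (auto simp: indicator_def)
  qed (use \<Omega>s in auto)
  then have "(\<integral>x. w x \<partial>lborel) = 0" using u(3) w by (simp add: integral_completion)
  moreover have "w = (\<lambda>x. p x - m x)" by (auto simp: p_def m_def fun_eq_iff)
  ultimately have "(\<integral>x. p x \<partial>lborel) = (\<integral>x. m x \<partial>lborel)" using ip im by simp
  moreover have "(\<integral>\<^sup>+x. ennreal (p x) \<partial>lborel) = ennreal (\<integral>x. p x \<partial>lborel)"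
    "(\<integral>\<^sup>+x. ennreal (m x) \<partial>lborel) = ennreal (\<integral>x. m x \<partial>lborel)"
    by (intro nn_integral_eq_integral ip im AE_I2; simp add: p_def m_def)+
  ultimately have pm: "(\<integral>\<^sup>+x. ennreal (p x) \<partial>lborel) = (\<integral>\<^sup>+x. ennreal (m x) \<partial>lborel)" by simp

  \<comment> \<open>Since \<open>p\<close> is 1 almost everywhere on \<open>\<Omega>s\<close>, its
    integral is positive. The integral of \<open>m\<close> is the same, so an infinite ratio would
    contradict the finiteness of \<open>TV m\<close>.\<close>
  have "emeasure lebesgue \<Omega>s = (\<integral>\<^sup>+x. indicator \<Omega>s x \<partial>lebesgue)" using assms(6) by simp
  also have "\<dots> \<le> (\<integral>\<^sup>+x. ennreal (p x) \<partial>lebesgue)"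
  proof (rule nn_integral_mono_AE)
    show "AE x in lebesgue. indicator \<Omega>s x \<le> ennreal (p x)"
      using us uw by eventually_elim (auto simp: p_def split: split_indicator)
  qed
  also have "\<dots> = (\<integral>\<^sup>+x. ennreal (p x) \<partial>lborel)" by (rule nn_integral_completion)
  finally have "(\<integral>\<^sup>+x. ennreal (p x) \<partial>lborel) > 0" using assms(9) by (rule less_le_trans[rotated])
  then have ratio_finite: "ratio < \<infinity>"
    using le_less_trans[OF ratio_m_le fm] unfolding pm by (auto simp: ennreal_mult_less_top)

  \<comment> \<open>Both bounds on t matter: \<open>t < 1\<close> keeps \<open>\<Omega>s\<close>,
    where u = 1, inside the level set, and \<open>0 \<le> t\<close> keeps the level set inside
    \<Omega> and away from \<open>\<Omega>m\<close>.\<close>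
  have comp_E: "T_competitor \<Omega> \<Omega>s \<Omega>m (E t)" if "0 \<le> t" "t < 1" for t
    unfolding T_competitor_def ae_subset_def
  proof (intro conjI)
    show "E t \<in> sets lebesgue" by (rule borel_leb) measurable
    show "AE x in lebesgue. x \<in> \<Omega>s \<longrightarrow> x \<in> E t"
      using us uw by eventually_elim (use that in \<open>auto simp: E_def\<close>)
    show "AE x in lebesgue. x \<in> E t \<longrightarrow> x \<in> \<Omega> - \<Omega>m"
      using u\<Omega> uw \<Omega>m\<Omega>u by eventually_elim (use that in \<open>auto simp: E_def\<close>)
  qed
  have TVw_le: "TV w \<le> T_functional \<Omega>m F" if "T_competitor \<Omega> \<Omega>s \<Omega>m F" for F
  proof (cases "T_functional \<Omega>m F < \<infinity>")
    case True
    note cf = competitor_function[OF \<Omega>s \<Omega>f \<Omega>m(1) \<Omega>m\<Omega> \<Omega>m(2) that True]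
    show ?thesis using order_trans[OF umin[OF cf(1)] cf(2)] TVw by simp
  qed (simp add: less_top[symmetric])

  \<comment> \<open>Optimality of almost every level\<close>
  have TE: "T_functional \<Omega>m (E t) \<le> Lp t + ratio * emeasure lborel (E t)" if "t \<ge> 0" for t
    unfolding T_functional_def ratio_def[symmetric] using PLp[OF that] pE[OF that] Eb
    by (simp add: add_right_mono)
  \<comment> \<open>A measurable upper bound for the functional at \<open>E t\<close>; it is
    compared with \<open>TV w\<close> over an interval of length 1.\<close>
  define g where "g t = Lp t + ratio * emeasure lborel (E t)" for t
  define J where "J = {0..<1::real}"
  have g_ge: "TV w \<le> g t" if "t \<in> J" for t
    using order_trans[OF TVw_le[OF comp_E] TE, of t] that unfolding g_def J_def by simp
  have [measurable]: "g \<in> borel_measurable borel" unfolding g_def[abs_def] by measurable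
  have [measurable]: "J \<in> sets borel" by (simp add: J_def)
  \<comment> \<open>Levels outside \<open>J\<close> only enlarge the right side. There the layer
    cake formula turns the volume term into the integral of \<open>p\<close>, which equals that of
    \<open>m\<close>, and the Cheeger bound absorbs it into \<open>TV m\<close>.\<close>
  have "(\<integral>\<^sup>+t. g t * indicator J t \<partial>lborel)
      \<le> (\<integral>\<^sup>+t. Lp t + ratio * (indicator {0..} t * emeasure lborel (E t)) \<partial>lborel)"
    by (intro nn_integral_mono) (auto simp: g_def J_def split: split_indicator)
  also have "\<dots> = (\<integral>\<^sup>+t. Lp t \<partial>lborel) + ratio * (\<integral>\<^sup>+t. indicator {0..} t * emeasure lborel (E t) \<partial>lborel)"
    by (simp add: nn_integral_add nn_integral_cmult)
  also have "(\<integral>\<^sup>+t. indicator {0..} t * emeasure lborel (E t) \<partial>lborel) = (\<integral>\<^sup>+x. ennreal (m x) \<partial>lborel)"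
    unfolding pm[symmetric] layer_cake[OF \<open>p \<in> borel_measurable borel\<close>]
    by (intro nn_integral_cong) (auto simp: pE split: split_indicator)
  also have "(\<integral>\<^sup>+t. Lp t \<partial>lborel) + ratio * (\<integral>\<^sup>+x. ennreal (m x) \<partial>lborel) \<le> TV w"
    using add_mono[OF ILp ratio_m_le] TVpm by (rule order_trans)
  finally have Ig: "(\<integral>\<^sup>+t. g t * indicator J t \<partial>lborel) \<le> TV w" .
  have TVfin: "TV w \<noteq> \<infinity>" using u(2) TVw by auto
  \<comment> \<open>\<open>J\<close> has length 1, so adding \<open>TV w\<close> back restores the
    integral of \<open>g\<close>. As \<open>g\<close> is at least \<open>TV w\<close> on
    \<open>J\<close> while its integral is at most \<open>TV w\<close>, the excess vanishes almost
    everywhere.\<close>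
  have "(\<integral>\<^sup>+t. (g t - TV w) * indicator J t \<partial>lborel) + TV w
      = (\<integral>\<^sup>+t. (g t - TV w) * indicator J t + TV w * indicator J t \<partial>lborel)"
    by (simp add: nn_integral_add nn_integral_cmult J_def)
  also have "\<dots> = (\<integral>\<^sup>+t. g t * indicator J t \<partial>lborel)"
    using g_ge by (intro nn_integral_cong) (auto simp: diff_add_cancel_ennreal split: split_indicator)
  also have "\<dots> \<le> 0 + TV w" using Ig by simp
  finally have "(\<integral>\<^sup>+t. (g t - TV w) * indicator J t \<partial>lborel) = 0"
    using TVfin by (simp add: add.commute[of _ "TV w"] ennreal_add_left_cancel_le)
  then have "AE t in lborel. (g t - TV w) * indicator J t = 0"
    by (subst (asm) nn_integral_0_iff_AE) auto
  then have AEg: "AE t in lborel. t \<in> J \<longrightarrow> g t \<le> TV w"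
    by eventually_elim (auto simp: diff_eq_0_iff_ennreal)

  \<comment> \<open>Passage to every level in [0, 1) by lower semicontinuity\<close>
  have T_le: "T_functional \<Omega>m (E t) \<le> TV w" if t: "0 \<le> t" "t < 1" for t
  proof -
    \<comment> \<open>Good levels are taken to the right of t, because the strict level sets
      increase to \<open>E t\<close> as s decreases to t. The width factor \<open>1 - t\<close>
      keeps them below 1.\<close>
    have "\<exists>s. t < s \<and> s < t + (1 - t) / real (Suc n) \<and> T_functional \<Omega>m (E s) \<le> TV w" for n
    proof -
      have "t < t + (1 - t) / real (Suc n)" using t by simp
      then obtain s where s: "t < s" "s < t + (1 - t) / real (Suc n)" "s \<in> J \<longrightarrow> g s \<le> TV w"
        using AE_interval_exists[OF AEg] by blast
      have "(1 - t) / real (Suc n) \<le> 1 - t" using t by (simp add: divide_le_eq mult_le_cancel_left1)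
      then have "s \<in> J" using s t unfolding J_def by auto
      then have "T_functional \<Omega>m (E s) \<le> TV w"
        using order_trans[OF TE, of s "TV w"] s t by (simp add: g_def)
      then show ?thesis using s by blast
    qed
    then obtain s where s: "\<And>n. t < s n" "\<And>n. s n < t + (1 - t) / real (Suc n)"
      "\<And>n. T_functional \<Omega>m (E (s n)) \<le> TV w" by metis
    have "(\<lambda>n. t + (1 - t) * (1 / real (Suc n))) \<longlonglongrightarrow> t + (1 - t) * 0"
      by (intro tendsto_intros LIMSEQ_Suc[OF lim_1_over_n])
    then have slim: "s \<longlonglongrightarrow> t"
      using s(1,2) by (intro tendsto_sandwich[OF _ _ tendsto_const, of t s]) (auto intro!: always_eventually less_imp_le)
    \<comment> \<open>Each point is eventually classified as by \<open>E t\<close>: if w(x) > t,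
      then s n falls below w(x); otherwise x lies in no \<open>E (s n)\<close>.\<close>
    have ind: "eventually (\<lambda>n. x \<in> E (s n) \<longleftrightarrow> x \<in> E t) sequentially" for x
    proof (cases "w x > t")
      case True
      then show ?thesis using order_tendstoD(2)[OF slim True] by (auto simp: E_def elim: eventually_mono)
    next
      case False
      then have "\<not> s n < w x" for n using s(1)[of n] by linarith
      then show ?thesis using False by (simp add: E_def)
    qed
    have "Per (E t) \<le> liminf (\<lambda>n. Per (E (s n)))"
      unfolding Per_def
    proof (rule TV_lsc)
      fix \<phi> assume \<phi>: "\<phi> \<in> test_fields"
      show "(\<lambda>n. \<integral>x. indicat_real (E (s n)) x * divergence \<phi> x \<partial>lebesgue)
          \<longlonglongrightarrow> (\<integral>x. indicat_real (E t) x * divergence \<phi> x \<partial>lebesgue)"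
      proof (rule pairing_tendsto_dominated[OF \<phi>])
        show "AE x in lebesgue. (\<lambda>n. indicat_real (E (s n)) x) \<longlonglongrightarrow> indicat_real (E t) x"
        proof (rule AE_I2)
          show "(\<lambda>n. indicat_real (E (s n)) x) \<longlonglongrightarrow> indicat_real (E t) x" for x
            by (intro tendsto_eventually eventually_mono[OF ind[of x]]) (simp add: indicator_def)
        qed
        show "AE x in lebesgue. \<bar>indicat_real (E (s n)) x\<bar> \<le> 1" for n by simp
        show "indicat_real (E t) \<in> borel_measurable lebesgue"
          by (rule borel_measurable_indicator[OF borel_leb[OF Eb]])
        show "indicat_real (E (s n)) \<in> borel_measurable lebesgue" for n
          by (rule borel_measurable_indicator[OF borel_leb[OF Eb]])
      qed (rule disjI2, rule refl)
    qed
    \<comment> \<open>The volume term is treated by Fatou's lemma, applied to the indicators scaled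
      by the ratio.\<close>
    moreover have "ratio * emeasure lborel (E t) \<le> liminf (\<lambda>n. ratio * emeasure lborel (E (s n)))"
    proof -
      have "ratio * emeasure lborel (E t) = (\<integral>\<^sup>+x. liminf (\<lambda>n. ratio * indicator (E (s n)) x) \<partial>lborel)"
      proof -
        have "liminf (\<lambda>n. ratio * indicator (E (s n)) x) = ratio * indicator (E t) x" for x
          by (intro lim_imp_Liminf tendsto_eventually eventually_mono[OF ind[of x]]) (simp_all add: indicator_def)
        then show ?thesis by (simp add: nn_integral_cmult)
      qed
      also have "\<dots> \<le> liminf (\<lambda>n. \<integral>\<^sup>+x. ratio * indicator (E (s n)) x \<partial>lborel)"
        by (rule nn_integral_liminf) measurable
      finally show ?thesis by (simp add: nn_integral_cmult)
    qed
    ultimately have "Per (E t) + ratio * emeasure lborel (E t)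
        \<le> liminf (\<lambda>n. Per (E (s n))) + liminf (\<lambda>n. ratio * emeasure lborel (E (s n)))"
      by (rule add_mono)
    also have "\<dots> \<le> TV w"
      using s(3) by (intro liminf_add_le_ennreal) (simp add: T_functional_def ratio_def)
    finally show ?thesis by (simp add: T_functional_def ratio_def)
  qed

  \<comment> \<open>Minimality of the level sets and the minimizer built from one of them\<close>
  have minE: "is_arg_min (T_functional \<Omega>m) (T_competitor \<Omega> \<Omega>s \<Omega>m) (E t)" if "0 \<le> t" "t < 1" for t
    unfolding is_arg_min_def
    using comp_E[OF that] order_trans[OF T_le[OF that] TVw_le] by (auto simp: not_less)
  have "is_arg_min (T_functional \<Omega>m) (T_competitor \<Omega> \<Omega>s \<Omega>m) {x. u x > t}" if t: "0 \<le> t" "t < 1" for t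
  proof -
    have eq: "AE x in lebesgue. x \<in> {x. u x > t} \<longleftrightarrow> x \<in> E t"
      using uw by eventually_elim (auto simp: E_def)
    have S: "{x. u x > t} \<in> sets lebesgue" using measurable_sets[OF ul, of "{t<..}"] by (simp add: vimage_def)
    have "T_functional \<Omega>m {x. u x > t} = T_functional \<Omega>m (E t)"
      by (rule T_functional_cong_AE[OF S borel_leb[OF Eb] eq])
    moreover have "T_competitor \<Omega> \<Omega>s \<Omega>m {x. u x > t}"
      using comp_E[OF t] S eq unfolding T_competitor_def ae_subset_def
      by (auto elim: eventually_elim2)
    ultimately show ?thesis using minE[OF t] unfolding is_arg_min_def by simp
  qed
  \<comment> \<open>The level set \<open>E 0\<close> serves as the Borel set \<Omega>1. The total
    variation of its competitor function is at most the functional at \<open>E 0\<close>, hence at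
    most \<open>TV w\<close>, which equals the minimal value \<open>TV u\<close>.\<close>
  moreover have "is_arg_min TV (\<lambda>v. v \<in> BV_diamond_1 \<Omega> \<Omega>s)
      (\<lambda>x. indicat_real (E 0) x - measure lebesgue (E 0) / measure lebesgue \<Omega>m * indicat_real \<Omega>m x)"
  proof -
    have T0: "T_functional \<Omega>m (E 0) \<le> TV w" by (rule T_le) simp_all
    have f: "T_functional \<Omega>m (E 0) < \<infinity>" using T0 TVfin by (auto simp: less_top intro: neq_top_trans)
    have c: "T_competitor \<Omega> \<Omega>s \<Omega>m (E 0)" by (rule comp_E) simp_all
    note cf = competitor_function[OF \<Omega>s \<Omega>f \<Omega>m(1) \<Omega>m\<Omega> \<Omega>m(2) c f]
    show ?thesis unfolding is_arg_min_def
      using cf(1) order_trans[OF order_trans[OF cf(2) T0]] umin TVw by (auto simp: not_less)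
  qed
  ultimately show ?thesis using minE[of 0] Eb[of 0] by auto
qed

end
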